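(* Let $k \leq n$ be positive integers. Then $\mathcal{A}_{n,k} = \mathcal{M}_{n,k}$. Moreover, the set of monomials $\mathcal{A}_{n,k}$ descends to a vector space basis of $R_{n,k}$.
   Context: For positive integers $k \le n$, $I_{n,k} \subseteq \mathbb{Q}[x_1,\dots,x_n]$ is the ideal $\langle x_1^k, \dots, x_n^k, e_n, e_{n-1}, \dots, e_{n-k+1}\rangle$, where $e_d = e_d(x_1,\dots,x_n)$ is the elementary symmetric polynomial of degree $d$, and $R_{n,k} := \mathbb{Q}[x_1,\dots,x_n]/I_{n,k}$. A shuffle of two sequences is an interleaving of them preserving the relative order of the entries of each. An $(n,k)$-staircase is a shuffle of the sequence $(0,1,\dots,k-1)$ and the sequence $(k-1,k-1,\dots,k-1)$ having $n-k$ entries. $\mathcal{A}_{n,k}$ (the $(n,k)$-Artin monomials) is the set of monomials $x_1^{a_1}\cdots x_n^{a_n}$ such that $(a_1,\dots,a_n)$ is componentwise $\leq$ some $(n,k)$-staircase. For $S = \{s_1 < \cdots < s_m\} \subseteq [n]=\{1,\dots,n\}$, the skip monomial is $\mathbf{x}(S) := x_{s_1}^{s_1} x_{s_2}^{s_2-1} \cdots x_{s_m}^{s_m-m+1}$. $\mathcal{M}_{n,k}$ (the $(n,k)$-nonskip monomials) is the set of monomials $m \in \mathbb{Q}[x_1,\dots,x_n]$ such that $\mathbf{x}(S) \nmid m$ for all $S \subseteq [n]$ with $|S| = n-k+1$, and $x_i^k \nmid m$ for all $1 \le i \le n$. *)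

theory Defs
  imports
    "HOL-Library.Poly_Mapping"
    "HOL-Algebra.QuotRing"
    "HOL-Algebra.Divisibility"
    "Jordan_Normal_Form.VS_Connect"
begin

hide_const (open) Multiset.mult Polynomial.smult Modules.module Ring_Hom.ring_hom

section \<open>The polynomial ring in n variables over the rationals\<close>

text \<open>A polynomial is a finitely supported map from exponent vectors to coefficients.
  The type allows the variables \<open>x\<^sub>i\<close> for all natural numbers \<open>i\<close>; the carrier of \<open>QX n\<close> keeps
  exactly the polynomials in \<open>x\<^sub>1, \<dots>, x\<^sub>n\<close>.\<close>

type_synonym expvec = "nat \<Rightarrow>\<^sub>0 nat"
type_synonym qpoly = "expvec \<Rightarrow>\<^sub>0 rat"

definition QX :: "nat \<Rightarrow> qpoly ring" where
  "QX n = \<lparr>carrier = {p. \<forall>a \<in> Poly_Mapping.keys p. Poly_Mapping.keys a \<subseteq> {1..n}},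
           mult = (*), one = 1, zero = 0, add = (+)\<rparr>"

definition monom_of :: "expvec \<Rightarrow> qpoly" where
  "monom_of a = Poly_Mapping.single a 1"

definition const_poly :: "rat \<Rightarrow> qpoly" where
  "const_poly c = Poly_Mapping.single 0 c"

definition var :: "nat \<Rightarrow> qpoly" where
  "var i = monom_of (Poly_Mapping.single i 1)"

definition monomials :: "nat \<Rightarrow> qpoly set" where
  "monomials n = {monom_of a | a. Poly_Mapping.keys a \<subseteq> {1..n}}"

section \<open>The ideal and the quotient ring\<close>

definition elem_sym :: "nat \<Rightarrow> nat \<Rightarrow> qpoly" where
  "elem_sym n d = (\<Sum>S | S \<subseteq> {1..n} \<and> card S = d. \<Prod>i\<in>S. var i)"

definition ideal_nk :: "nat \<Rightarrow> nat \<Rightarrow> qpoly set" where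
  "ideal_nk n k =
     Idl\<^bsub>QX n\<^esub> ({var i ^ k | i. i \<in> {1..n}} \<union> {elem_sym n d | d. d \<in> {n - k + 1..n}})"

definition coset_nk :: "nat \<Rightarrow> nat \<Rightarrow> qpoly \<Rightarrow> qpoly set" where
  "coset_nk n k p = ideal_nk n k +>\<^bsub>QX n\<^esub> p"

text \<open>The quotient ring together with its rational vector space structure: a scalar \<open>c\<close> acts as
  multiplication by the class of the constant polynomial \<open>c\<close>.\<close>

definition R_nk :: "nat \<Rightarrow> nat \<Rightarrow> (rat, qpoly set) module" where
  "R_nk n k = (let Q = QX n Quot ideal_nk n k in
     \<lparr>carrier = carrier Q, mult = mult Q, one = one Q, zero = zero Q, add = add Q,
      smult = (\<lambda>c v. coset_nk n k (const_poly c) \<otimes>\<^bsub>Q\<^esub> v)\<rparr>)"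

section \<open>Artin monomials and nonskip monomials\<close>

definition staircases :: "nat \<Rightarrow> nat \<Rightarrow> nat list set" where
  "staircases n k = shuffles [0..<k] (replicate (n - k) (k - 1))"

text \<open>Lists are indexed from 0, hence the shift in \<open>c ! (i - 1)\<close>.\<close>

definition artin_monomials :: "nat \<Rightarrow> nat \<Rightarrow> qpoly set" where
  "artin_monomials n k =
     {monom_of a | a. Poly_Mapping.keys a \<subseteq> {1..n} \<and>
        (\<exists>c \<in> staircases n k. \<forall>i \<in> {1..n}. Poly_Mapping.lookup a i \<le> c ! (i - 1))}"

text \<open>If \<open>s\<close> is the \<open>j\<close>-th smallest element of \<open>S\<close>, then \<open>card {t \<in> S. t < s} = j - 1\<close>, so its
  exponent is \<open>s - j + 1\<close>. The subtraction does not truncate for \<open>S \<subseteq> {1..n}\<close>, as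
  \<open>s \<ge> j\<close>.\<close>

definition skip_monomial :: "nat set \<Rightarrow> qpoly" where
  "skip_monomial S = (\<Prod>s\<in>S. var s ^ (s - card {t \<in> S. t < s}))"

definition nonskip_monomials :: "nat \<Rightarrow> nat \<Rightarrow> qpoly set" where
  "nonskip_monomials n k =
     {m \<in> monomials n.
        (\<forall>S. S \<subseteq> {1..n} \<and> card S = n - k + 1 \<longrightarrow> \<not> (skip_monomial S divides\<^bsub>QX n\<^esub> m)) \<and>
        (\<forall>i \<in> {1..n}. \<not> (var i ^ k divides\<^bsub>QX n\<^esub> m))}"

section \<open>Well-definedness\<close>

lemma QX_simps:
  "mult (QX n) = (*)" "add (QX n) = (+)" "one (QX n) = 1" "zero (QX n) = 0"
  by (simp_all add: QX_def)

lemma carrier_add: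
  assumes "p \<in> carrier (QX n)" "q \<in> carrier (QX n)"
  shows "p + q \<in> carrier (QX n)"
  using assms Poly_Mapping.keys_add[of p q] by (fastforce simp: QX_def)

lemma carrier_mult:
  assumes "p \<in> carrier (QX n)" "q \<in> carrier (QX n)"
  shows "p * q \<in> carrier (QX n)"
proof -
  have "Poly_Mapping.keys c \<subseteq> {1..n}" if c: "c \<in> Poly_Mapping.keys (p * q)" for c
  proof -
    obtain a b where ab: "a \<in> Poly_Mapping.keys p" "b \<in> Poly_Mapping.keys q" "c = a + b"
      using c Poly_Mapping.keys_mult[of p q] by blast
    then have "Poly_Mapping.keys a \<subseteq> {1..n}" "Poly_Mapping.keys b \<subseteq> {1..n}"
      using assms by (auto simp: QX_def)
    then show ?thesis using Poly_Mapping.keys_add[of a b] ab(3) by blast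
  qed
  then show ?thesis by (simp add: QX_def)
qed

lemma carrier_const: "const_poly c \<in> carrier (QX n)"
  by (simp add: QX_def const_poly_def)

lemma carrier_monom: "monom_of a \<in> carrier (QX n) \<longleftrightarrow> Poly_Mapping.keys a \<subseteq> {1..n}"
  by (simp add: QX_def monom_of_def)

lemma carrier_one: "1 \<in> carrier (QX n)"
  by (simp add: QX_def)

lemma carrier_power: "p \<in> carrier (QX n) \<Longrightarrow> p ^ m \<in> carrier (QX n)"
  by (induction m) (auto intro: carrier_mult carrier_one)

lemma carrier_sum: "(\<And>i. i \<in> A \<Longrightarrow> f i \<in> carrier (QX n)) \<Longrightarrow> sum f A \<in> carrier (QX n)"
proof (induction A rule: infinite_finite_induct)
  case (insert x F)
  then show ?case by (auto intro: carrier_add)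
qed (auto simp: QX_def)

lemma carrier_prod: "(\<And>i. i \<in> A \<Longrightarrow> f i \<in> carrier (QX n)) \<Longrightarrow> prod f A \<in> carrier (QX n)"
proof (induction A rule: infinite_finite_induct)
  case (insert x F)
  then show ?case by (auto intro: carrier_mult)
qed (auto intro: carrier_one)

lemma carrier_var: "i \<in> {1..n} \<Longrightarrow> var i \<in> carrier (QX n)"
  by (simp add: var_def carrier_monom)

lemma QX_cring: "cring (QX n)"
proof (rule cringI)
  show "abelian_group (QX n)"
  proof (rule abelian_groupI)
    fix p assume p: "p \<in> carrier (QX n)"
    then have "- p \<in> carrier (QX n)" by (simp add: QX_def)
    then show "\<exists>q\<in>carrier (QX n). q \<oplus>\<^bsub>QX n\<^esub> p = \<zero>\<^bsub>QX n\<^esub>"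
      by (intro bexI[of _ "- p"]) (simp_all add: QX_def)
  next
    fix p q assume "p \<in> carrier (QX n)" "q \<in> carrier (QX n)"
    then show "p \<oplus>\<^bsub>QX n\<^esub> q \<in> carrier (QX n)"
      by (simp only: QX_simps carrier_add)
  qed (simp_all add: QX_def add.assoc add.commute add.left_commute)
  show "comm_monoid (QX n)"
  proof (rule comm_monoidI)
    fix p q assume "p \<in> carrier (QX n)" "q \<in> carrier (QX n)"
    then show "p \<otimes>\<^bsub>QX n\<^esub> q \<in> carrier (QX n)"
      by (simp only: QX_simps carrier_mult)
  qed (simp_all add: QX_def mult.assoc mult.commute mult.left_commute)
qed (simp add: QX_def distrib_right)

lemma ideal_nk_ideal: "ideal (ideal_nk n k) (QX n)"
proof -
  interpret cring "QX n" by (rule QX_cring)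
  have "elem_sym n d \<in> carrier (QX n)" for d
    unfolding elem_sym_def by (intro carrier_sum carrier_prod carrier_var) auto
  then show ?thesis
    unfolding ideal_nk_def
    by (intro genideal_ideal) (auto intro!: carrier_power carrier_var)
qed

lemma coset_const_hom: "(\<lambda>c. coset_nk n k (const_poly c)) \<in> ring_hom class_ring (QX n Quot ideal_nk n k)"
proof -
  interpret ideal "ideal_nk n k" "QX n" by (rule ideal_nk_ideal)
  have "const_poly \<in> ring_hom class_ring (QX n)"
  proof (rule ring_hom_memI)
    fix c show "const_poly c \<in> carrier (QX n)" by (rule carrier_const)
  qed (auto simp: QX_def const_poly_def Poly_Mapping.mult_single single_add)
  then show ?thesis
    using ring_hom_trans[OF _ rcos_ring_hom, of const_poly class_ring]
    by (simp add: comp_def coset_nk_def)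
qed

lemma field_rat: "field (class_ring :: rat ring)"
  by (rule class_field.field_axioms)

text \<open>\<^const>\<open>R_nk\<close> is indeed a rational vector space, so that \<^const>\<open>vectorspace.basis\<close> has
  its intended meaning on it.\<close>

lemma R_nk_vectorspace: "vectorspace class_ring (R_nk n k)"
proof -
  define Q where "Q = QX n Quot ideal_nk n k"
  define h where "h = (\<lambda>c. coset_nk n k (const_poly c))"
  have Qc: "cring Q"
    unfolding Q_def using ideal.quotient_is_cring[OF ideal_nk_ideal QX_cring] .
  interpret Q: cring Q by (rule Qc)
  have h: "h \<in> ring_hom class_ring Q"
    unfolding Q_def h_def by (rule coset_const_hom)
  have hc: "h c \<in> carrier Q" for c
    using ring_hom_closed[OF h] by simp
  have ha: "h (a + b) = h a \<oplus>\<^bsub>Q\<^esub> h b" and hm: "h (a * b) = h a \<otimes>\<^bsub>Q\<^esub> h b" for a b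
    using ring_hom_add[OF h, of a b] ring_hom_mult[OF h, of a b] by simp_all
  have h1: "h 1 = \<one>\<^bsub>Q\<^esub>" using ring_hom_one[OF h] by simp
  have R: "R_nk n k = \<lparr>carrier = carrier Q, mult = mult Q, one = one Q, zero = zero Q,
      add = add Q, smult = (\<lambda>c v. h c \<otimes>\<^bsub>Q\<^esub> v)\<rparr>"
    unfolding R_nk_def Q_def h_def by (simp add: Let_def)
  have "module class_ring (R_nk n k)"
  proof (rule moduleI)
    show "cring (class_ring :: rat ring)" using field_rat by (rule fieldE(1))
    show "abelian_group (R_nk n k)"
    proof (rule abelian_groupI)
      fix v assume "v \<in> carrier (R_nk n k)"
      then show "\<exists>w\<in>carrier (R_nk n k). w \<oplus>\<^bsub>R_nk n k\<^esub> v = \<zero>\<^bsub>R_nk n k\<^esub>"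
        by (intro bexI[of _ "\<ominus>\<^bsub>Q\<^esub> v"]) (simp_all add: R Q.l_neg)
    qed (simp_all add: R Q.a_ac)
  qed (simp_all add: R hc ha hm h1 Q.l_distr Q.r_distr Q.m_assoc)
  then show ?thesis
    using field_rat by (simp add: vectorspace_def)
qed

end

theory Submission
  imports Defs
begin

text \<open>The statement is generalised to ideals generated by the \<open>x\<^sub>i\<^sup>k\<close> and the \<open>e\<^sub>r\<close> with
  \<open>r > n - j\<close>, and to monomials bounded by a shuffle of \<open>(0,\<dots>,j-1)\<close> with copies of \<open>k-1\<close>.
  These monomials satisfy a recursion on the last variable: the exponent \<open>i < k\<close> of \<open>x\<^sub>n\<close> is
  arbitrary, and \<open>j\<close> drops by one exactly when \<open>i < j\<close>.  The nonskip condition satisfies the same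
  recursion, so both sets of monomials agree.

  They span the quotient by induction on \<open>n\<close>, filtering by powers of \<open>x\<^sub>n\<close>, because
  \<open>e\<^sub>r(x\<^sub>1,\<dots>,x\<^sub>n\<^sub>-\<^sub>1) = e\<^sub>r - x\<^sub>n e\<^sub>r\<^sub>-\<^sub>1(x\<^sub>1,\<dots>,x\<^sub>n\<^sub>-\<^sub>1)\<close>, and iterating this from
  \<open>e\<^sub>n(x\<^sub>1,\<dots>,x\<^sub>n\<^sub>-\<^sub>1) = 0\<close> shows that \<open>x\<^sub>n\<^sup>j e\<^sub>n\<^sub>-\<^sub>j(x\<^sub>1,\<dots>,x\<^sub>n\<^sub>-\<^sub>1)\<close> lies in the ideal.

  For independence, fix a set \<open>V\<close> of \<open>k\<close> rationals and a subset \<open>T\<close> of size \<open>j\<close>, and consider the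
  points of \<open>V\<^sup>n\<close> in which every element of \<open>T\<close> occurs as a coordinate.  The same recursion and
  Vandermonde systems show that the monomials are independent as functions on these points.  Each
  homogeneous generator of the ideal becomes a function vanishing on these points after adding terms
  of lower degree, so a homogeneous relation modulo the ideal, once its lower terms are reduced to the
  spanning monomials, is a relation between functions, hence trivial.\<close>

section \<open>Polynomials as a rational vector space spanned by monomials\<close>

interpretation qv: vector_space "\<lambda>c p. const_poly c * (p :: qpoly)"
  by unfold_locales
    (simp_all add: const_poly_def algebra_simps single_add mult_single flip: mult.assoc)

lemma monom_of_0: "monom_of 0 = 1"
  by (simp add: monom_of_def)

lemma monom_of_add: "monom_of (a + b) = monom_of a * monom_of b"
  by (simp add: monom_of_def mult_single)

lemma monom_of_sum: "finite A \<Longrightarrow> monom_of (sum f A) = (\<Prod>i\<in>A. monom_of (f i))"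
  by (induction A rule: finite_induct) (simp_all add: monom_of_0 monom_of_add)

lemma inj_monom_of: "monom_of a = monom_of b \<longleftrightarrow> a = b"
  by (simp add: monom_of_def) (metis keys_single one_neq_zero singleton_inject)

lemma var_power: "var i ^ m = monom_of (Poly_Mapping.single i m)"
  by (induction m) (simp_all add: monom_of_0 var_def flip: monom_of_add single_add)

lemma lookup_const_mult: "Poly_Mapping.lookup (const_poly c * p) a = c * Poly_Mapping.lookup p a"
proof -
  have "const_poly c * p = Poly_Mapping.map ((*) c) p"
    by (simp add: const_poly_def mult_map_scale_conv_mult)
  then show ?thesis by (simp add: map.rep_eq when_def)
qed

lemma lookup_monom_of: "Poly_Mapping.lookup (monom_of a) b = (if a = b then 1 else 0)"
  by (simp add: monom_of_def lookup_single when_def)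

lemma qpoly_expand:
  assumes "finite A" "Poly_Mapping.keys p \<subseteq> A"
  shows "p = (\<Sum>a\<in>A. const_poly (Poly_Mapping.lookup p a) * monom_of a)"
proof (rule poly_mapping_eqI)
  fix b
  have "(\<Sum>a\<in>A. Poly_Mapping.lookup (const_poly (Poly_Mapping.lookup p a) * monom_of a) b)
      = (\<Sum>a\<in>A. if a = b then Poly_Mapping.lookup p b else 0)"
    by (intro sum.cong) (auto simp: lookup_const_mult lookup_monom_of)
  also have "\<dots> = Poly_Mapping.lookup p b"
    using assms by (auto simp: in_keys_iff)
  finally show "Poly_Mapping.lookup p b =
    Poly_Mapping.lookup (\<Sum>a\<in>A. const_poly (Poly_Mapping.lookup p a) * monom_of a) b"
    by (simp add: lookup_sum)
qed

lemma in_span_monomials: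
  assumes "\<And>a. a \<in> Poly_Mapping.keys p \<Longrightarrow> a \<in> A"
  shows "p \<in> qv.span (monom_of ` A)"
proof -
  have "(\<Sum>a\<in>Poly_Mapping.keys p. const_poly (Poly_Mapping.lookup p a) * monom_of a)
      \<in> qv.span (monom_of ` A)"
    using assms by (intro qv.span_sum qv.span_scale qv.span_base) auto
  then show ?thesis using qpoly_expand[of "Poly_Mapping.keys p" p] by simp
qed

lemma span_monomials_keys:
  "p \<in> qv.span (monom_of ` A) \<Longrightarrow> Poly_Mapping.keys p \<subseteq> A"
proof (induction rule: qv.span_induct_alt)
  case (step c x y)
  have "Poly_Mapping.lookup y a \<noteq> 0 \<Longrightarrow> a \<in> A" for a using step(2) by (auto simp: in_keys_iff)
  then show ?case using step(1)
    by (auto simp: in_keys_iff lookup_add lookup_const_mult lookup_monom_of split: if_splits)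
qed simp

lemma qv_span_subsetI: "A \<subseteq> qv.span B \<Longrightarrow> p \<in> qv.span A \<Longrightarrow> p \<in> qv.span B"
  using qv.span_minimal[OF _ qv.subspace_span, of A B] by blast

text \<open>Multiplication by \<open>q\<close> is linear, so only its effect on the spanning set
  matters.\<close>

lemma span_mult_image:
  assumes "p \<in> qv.span A" "\<And>x. x \<in> A \<Longrightarrow> q * x \<in> qv.span B"
  shows "q * p \<in> qv.span B"
  using assms(1)
proof (induction rule: qv.span_induct_alt)
  case (step c x y)
  have "q * (const_poly c * x + y) = const_poly c * (q * x) + q * y"
    by (simp add: algebra_simps)
  then show ?case using step assms(2) by (simp add: qv.span_add qv.span_scale)
qed (simp add: qv.span_zero)

section \<open>Exponent vectors\<close>

definition exps :: "nat \<Rightarrow> expvec set" where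
  "exps n = {a. Poly_Mapping.keys a \<subseteq> {1..n}}"

definition deg :: "expvec \<Rightarrow> nat" where
  "deg a = (\<Sum>i\<in>Poly_Mapping.keys a. Poly_Mapping.lookup a i)"

lemma exps_0: "exps 0 = {0}"
  by (auto simp: exps_def)

lemma zero_in_exps [simp]: "0 \<in> exps n"
  by (simp add: exps_def)

lemma exps_mono: "m \<le> n \<Longrightarrow> a \<in> exps m \<Longrightarrow> a \<in> exps n"
  by (auto simp: exps_def)

lemma exps_add: "a \<in> exps n \<Longrightarrow> b \<in> exps n \<Longrightarrow> a + b \<in> exps n"
  using Poly_Mapping.keys_add[of a b] by (auto simp: exps_def)

lemma exps_single: "i \<in> {1..n} \<Longrightarrow> Poly_Mapping.single i m \<in> exps n"
  by (simp add: exps_def)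

lemma lookup_outside_exps: "a \<in> exps n \<Longrightarrow> i \<notin> {1..n} \<Longrightarrow> Poly_Mapping.lookup a i = 0"
  by (auto simp: exps_def in_keys_iff)

lemma exps_Suc_decomp:
  assumes "a \<in> exps (Suc m)"
  obtains b where "b \<in> exps m" "a = b + Poly_Mapping.single (Suc m) (Poly_Mapping.lookup a (Suc m))"
proof
  let ?b = "a - Poly_Mapping.single (Suc m) (Poly_Mapping.lookup a (Suc m))"
  have lk: "Poly_Mapping.lookup ?b i = (if i = Suc m then 0 else Poly_Mapping.lookup a i)" for i
    by (auto simp: lookup_minus lookup_single when_def)
  show "?b \<in> exps m"
    unfolding exps_def mem_Collect_eq
  proof
    fix i assume "i \<in> Poly_Mapping.keys ?b"
    then have "i \<noteq> Suc m" "i \<in> Poly_Mapping.keys a" by (auto simp: in_keys_iff lk split: if_splits)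
    then show "i \<in> {1..m}" using assms by (fastforce simp: exps_def)
  qed
  show "a = ?b + Poly_Mapping.single (Suc m) (Poly_Mapping.lookup a (Suc m))"
    by (rule poly_mapping_eqI) (auto simp: lookup_add lk lookup_single when_def)
qed

lemma exps_Suc_inj:
  assumes "a \<in> exps m" "b \<in> exps m"
    "a + Poly_Mapping.single (Suc m) i = b + Poly_Mapping.single (Suc m) j"
  shows "a = b \<and> i = j"
proof -
  have "Poly_Mapping.lookup a (Suc m) = 0" "Poly_Mapping.lookup b (Suc m) = 0"
    using assms(1,2) by (auto simp: lookup_outside_exps)
  then have "i = j"
    using arg_cong[OF assms(3), of "\<lambda>p. Poly_Mapping.lookup p (Suc m)"] by (simp add: lookup_add)
  then show ?thesis using assms(3) by simp
qed

lemma deg_superset: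
  "finite A \<Longrightarrow> Poly_Mapping.keys a \<subseteq> A \<Longrightarrow> deg a = (\<Sum>i\<in>A. Poly_Mapping.lookup a i)"
  unfolding deg_def by (rule sum.mono_neutral_left) (auto simp: in_keys_iff)

lemma deg_0 [simp]: "deg 0 = 0"
  by (simp add: deg_def)

lemma deg_single [simp]: "deg (Poly_Mapping.single i m) = m"
  by (simp add: deg_def)

lemma deg_add: "deg (a + b) = deg a + deg b"
proof -
  let ?A = "Poly_Mapping.keys a \<union> Poly_Mapping.keys b"
  have "deg (a + b) = (\<Sum>i\<in>?A. Poly_Mapping.lookup (a + b) i)"
    using Poly_Mapping.keys_add[of a b] by (intro deg_superset) auto
  also have "\<dots> = deg a + deg b"
    by (simp add: lookup_add sum.distrib deg_superset[of ?A])
  finally show ?thesis .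
qed

lemma deg_sum: "deg (sum f A) = (\<Sum>i\<in>A. deg (f i))"
  by (induction A rule: infinite_finite_induct) (simp_all add: deg_add)

section \<open>Elementary symmetric polynomials\<close>

lemma elem_sym_monom:
  "elem_sym n d =
    (\<Sum>S | S \<subseteq> {1..n} \<and> card S = d. monom_of (\<Sum>i\<in>S. Poly_Mapping.single i 1))"
  unfolding elem_sym_def
  by (intro sum.cong refl, subst monom_of_sum) (auto simp: var_def intro: finite_subset)

lemma elem_sym_0: "elem_sym n 0 = 1"
proof -
  have "{S. S \<subseteq> {1..n} \<and> card S = 0} = {{}}"
    by (auto simp: card_eq_0_iff dest: finite_subset)
  then show ?thesis by (simp add: elem_sym_def)
qed

lemma elem_sym_gt: "n < d \<Longrightarrow> elem_sym n d = 0"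
proof -
  assume "n < d"
  then have "\<not> (S \<subseteq> {1..n} \<and> card S = d)" for S
    using card_mono[of "{1..n}" S] by auto
  then have "{S. S \<subseteq> {1..n} \<and> card S = d} = {}" by blast
  then show ?thesis unfolding elem_sym_def by (simp only: sum.empty)
qed

text \<open>The subsets of size \<open>Suc d\<close> are split by whether they contain
  \<open>Suc m\<close>; those that do come from inserting it into a subset of size
  \<open>d\<close>.\<close>

lemma elem_sym_Suc:
  "elem_sym (Suc m) (Suc d) = elem_sym m (Suc d) + var (Suc m) * elem_sym m d"
proof -
  let ?P = "\<lambda>(n::nat) d. {S. S \<subseteq> {1..n} \<and> card S = d}"
  have fin: "finite S" if "S \<subseteq> {1..m}" for S using that finite_subset by blast
  have notin: "Suc m \<notin> S" if "S \<subseteq> {1..m}" for S using that by auto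
  have eq: "?P (Suc m) (Suc d) = ?P m (Suc d) \<union> insert (Suc m) ` ?P m d"
  proof (intro equalityI subsetI)
    fix S assume S: "S \<in> ?P (Suc m) (Suc d)"
    show "S \<in> ?P m (Suc d) \<union> insert (Suc m) ` ?P m d"
    proof (cases "Suc m \<in> S")
      case True
      then have "S = insert (Suc m) (S - {Suc m})" "S - {Suc m} \<in> ?P m d"
        using S by (auto simp: card_Diff_singleton le_Suc_eq)
      then show ?thesis by blast
    next
      case False
      then show ?thesis using S by (auto simp: le_Suc_eq subset_iff)
    qed
  next
    fix S assume "S \<in> ?P m (Suc d) \<union> insert (Suc m) ` ?P m d"
    then show "S \<in> ?P (Suc m) (Suc d)"
    proof
      assume "S \<in> insert (Suc m) ` ?P m d"
      then obtain S' where S': "S = insert (Suc m) S'" "S' \<subseteq> {1..m}" "card S' = d" by blast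
      moreover have "card S = Suc d"
        using S' fin[OF S'(2)] notin[OF S'(2)] by simp
      ultimately show ?thesis by auto
    qed auto
  qed
  have inj: "inj_on (insert (Suc m)) (?P m d)"
    by (rule inj_onI) (metis (mono_tags, lifting) insert_ident mem_Collect_eq notin)
  have finP: "finite (?P n d)" for n d by (rule finite_subset[of _ "Pow {1..n}"]) auto
  have disj: "?P m (Suc d) \<inter> insert (Suc m) ` ?P m d = {}"
    by (fastforce dest: notin)
  have "elem_sym (Suc m) (Suc d) =
      elem_sym m (Suc d) + (\<Sum>S\<in>insert (Suc m) ` ?P m d. \<Prod>i\<in>S. var i)"
    unfolding elem_sym_def eq
    by (rule sum.union_disjoint[OF finP finite_imageI[OF finP] disj])
  also have "(\<Sum>S\<in>insert (Suc m) ` ?P m d. \<Prod>i\<in>S. var i)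
      = (\<Sum>S\<in>?P m d. \<Prod>i\<in>insert (Suc m) S. var i)"
    using sum.reindex[OF inj, of "prod var"] unfolding comp_def .
  also have "\<dots> = (\<Sum>S\<in>?P m d. var (Suc m) * (\<Prod>i\<in>S. var i))"
  proof (rule sum.cong[OF refl])
    fix S assume "S \<in> ?P m d"
    then have "finite S" "Suc m \<notin> S" using fin notin by blast+
    then show "(\<Prod>i\<in>insert (Suc m) S. var i) = var (Suc m) * (\<Prod>i\<in>S. var i)"
      by (rule prod.insert)
  qed
  finally show ?thesis by (simp add: elem_sym_def sum_distrib_left)
qed

lemma elem_sym_span:
  "elem_sym n d \<in> qv.span (monom_of ` {a \<in> exps n. deg a = d})"
proof -
  have "monom_of (\<Sum>i\<in>S. Poly_Mapping.single i 1) \<in> monom_of ` {a \<in> exps n. deg a = d}"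
    if "S \<subseteq> {1..n}" "card S = d" for S
  proof -
    have "Poly_Mapping.keys (\<Sum>i\<in>S. Poly_Mapping.single i (1::nat)) \<subseteq> (\<Union>i\<in>S. {i})"
      using keys_sum[of "\<lambda>i. Poly_Mapping.single i (1::nat)" S] by simp
    then show ?thesis using that by (auto simp: exps_def deg_sum)
  qed
  then show ?thesis
    unfolding elem_sym_monom by (intro qv.span_sum qv.span_base) auto
qed

section \<open>Artin exponents and skip monomials\<close>

text \<open>Here \<open>j\<close> is the number of rising entries \<open>0, ..., j - 1\<close> still
  to be placed. An exponent \<open>i < j\<close> of the last variable fits below the rising entry
  \<open>j - 1\<close>, and spending that entry leaves the weaker condition on the rest; an exponent
  \<open>i \<ge> j\<close> has to sit below a constant \<open>k - 1\<close>. With no positions left,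
  pending rising entries cannot be placed, hence the empty set for \<open>j > 0\<close>.\<close>

fun artin_exps :: "nat \<Rightarrow> nat \<Rightarrow> nat \<Rightarrow> expvec set" where
  "artin_exps 0 k j = (if j = 0 then {0} else {})"
| "artin_exps (Suc m) k j = {b + Poly_Mapping.single (Suc m) i | b i.
     i < k \<and> b \<in> artin_exps m k (if i < j then j - 1 else j)}"

lemma artin_exps_SucI:
  "i < k \<Longrightarrow> b \<in> artin_exps m k (if i < j then j - 1 else j) \<Longrightarrow>
    b + Poly_Mapping.single (Suc m) i \<in> artin_exps (Suc m) k j"
  unfolding artin_exps.simps by blast

lemma artin_exps_in_exps: "a \<in> artin_exps n k j \<Longrightarrow> a \<in> exps n"
proof (induction n arbitrary: a j)
  case (Suc m)
  then obtain b i where "a = b + Poly_Mapping.single (Suc m) i" "b \<in> exps m" by auto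
  then show ?case by (auto intro!: exps_add exps_single intro: exps_mono[of m])
qed (auto split: if_splits)

lemma artin_exps_Suc_iff:
  assumes "b \<in> exps m"
  shows "b + Poly_Mapping.single (Suc m) i \<in> artin_exps (Suc m) k j \<longleftrightarrow>
    i < k \<and> b \<in> artin_exps m k (if i < j then j - 1 else j)"
proof
  assume "b + Poly_Mapping.single (Suc m) i \<in> artin_exps (Suc m) k j"
  then obtain b' i' where *: "b + Poly_Mapping.single (Suc m) i = b' + Poly_Mapping.single (Suc m) i'"
    "i' < k" "b' \<in> artin_exps m k (if i' < j then j - 1 else j)" by auto
  then show "i < k \<and> b \<in> artin_exps m k (if i < j then j - 1 else j)"
    using exps_Suc_inj[OF assms artin_exps_in_exps[OF *(3)] *(1)] by simp
qed (blast intro: artin_exps_SucI)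

lemma finite_artin_exps: "finite (artin_exps n k j)"
proof (induction n arbitrary: j)
  case (Suc m)
  have "artin_exps (Suc m) k j = (\<Union>i<k. (\<lambda>b. b + Poly_Mapping.single (Suc m) i) `
      artin_exps m k (if i < j then j - 1 else j))"
    unfolding artin_exps.simps by blast
  then show ?case using Suc by simp
qed simp

text \<open>Fewer rising entries to place means fewer constraints. For \<open>i = j - 1\<close> both
  recursions ask for the same parameter on the remaining variables; otherwise the induction
  hypothesis lowers it by one.\<close>

lemma artin_exps_antimono: "artin_exps n k j \<subseteq> artin_exps n k (j - 1)"
proof (induction n arbitrary: j)
  case (Suc m)
  show ?case
  proof
    fix a assume "a \<in> artin_exps (Suc m) k j"
    then obtain b i where a: "a = b + Poly_Mapping.single (Suc m) i" "i < k"
      "b \<in> artin_exps m k (if i < j then j - 1 else j)" by auto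
    have "b \<in> artin_exps m k (if i < j - 1 then j - 1 - 1 else j - 1)"
      using a(3) Suc[of j] Suc[of "j - 1"] by (auto split: if_splits)
    then show "a \<in> artin_exps (Suc m) k (j - 1)"
      using a(1,2) artin_exps_SucI by blast
  qed
qed auto

subsection \<open>Staircases\<close>

lemma snoc_in_shuffles_leftI: "zs \<in> shuffles xs ys \<Longrightarrow> zs @ [x] \<in> shuffles (xs @ [x]) ys"
proof (induction xs ys arbitrary: zs rule: shuffles.induct)
  case (1 ys)
  have "ys @ [x] \<in> shuffles [x] ys" by (induction ys) (auto simp: Cons_in_shuffles_iff)
  then show ?case using 1 by simp
qed (auto simp: Cons_in_shuffles_iff)

lemma snoc_in_shuffles_rightI: "zs \<in> shuffles xs ys \<Longrightarrow> zs @ [y] \<in> shuffles xs (ys @ [y])"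
  using snoc_in_shuffles_leftI[of zs ys xs y] by (simp add: shuffles_commutes)

lemma rev_in_shuffles: "zs \<in> shuffles xs ys \<Longrightarrow> rev zs \<in> shuffles (rev xs) (rev ys)"
proof (induction xs ys arbitrary: zs rule: shuffles.induct)
  case (3 x xs y ys)
  then show ?case
    using snoc_in_shuffles_leftI[of _ "rev xs" "rev (y # ys)" x]
      snoc_in_shuffles_rightI[of _ "rev (x # xs)" "rev ys" y]
    by auto
qed auto

text \<open>The recursion on exponent vectors removes the last position, so shuffles have to be
  decomposed at their end. Reversing both sequences reduces this to the decomposition at the
  head.\<close>

lemma snoc_in_shuffles_iff:
  "zs @ [z] \<in> shuffles xs ys \<longleftrightarrow>
    xs \<noteq> [] \<and> last xs = z \<and> zs \<in> shuffles (butlast xs) ys \<or>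
    ys \<noteq> [] \<and> last ys = z \<and> zs \<in> shuffles xs (butlast ys)" (is "?L \<longleftrightarrow> ?R1 \<or> ?R2")
proof
  assume ?L
  then have "z # rev zs \<in> shuffles (rev xs) (rev ys)" using rev_in_shuffles by fastforce
  then have "xs \<noteq> [] \<and> last xs = z \<and> rev zs \<in> shuffles (rev (butlast xs)) (rev ys) \<or>
    ys \<noteq> [] \<and> last ys = z \<and> rev zs \<in> shuffles (rev xs) (rev (butlast ys))"
    by (simp add: Cons_in_shuffles_iff hd_rev butlast_rev flip: butlast_rev) (metis hd_rev rev_rev_ident butlast_rev)
  then show "?R1 \<or> ?R2" by (metis rev_in_shuffles rev_rev_ident)
next
  assume "?R1 \<or> ?R2"
  then show ?L
    by (metis append_butlast_last_id snoc_in_shuffles_leftI snoc_in_shuffles_rightI)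
qed

text \<open>The final entry of a staircase is \<open>j - 1\<close> or \<open>k - 1\<close>, and
  deleting it leaves a shorter staircase for \<open>j - 1\<close> or for \<open>j\<close>. The
  parameter \<open>j\<close> varies in the induction because it drops along the way.\<close>

lemma artin_exps_staircase:
  assumes "1 \<le> k" "j \<le> k"
  shows "a \<in> artin_exps n k j \<longleftrightarrow> j \<le> n \<and> a \<in> exps n \<and>
    (\<exists>c \<in> shuffles [0..<j] (replicate (n - j) (k - 1)).
       \<forall>i \<in> {1..n}. Poly_Mapping.lookup a i \<le> c ! (i - 1))"
  using assms
proof (induction n arbitrary: a j)
  case 0
  then show ?case by (auto simp: exps_0)
next
  case (Suc m)
  let ?R = "\<lambda>n j a. \<exists>c \<in> shuffles [0..<j] (replicate (n - j) (k - 1)).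
       \<forall>i \<in> {1..n}. Poly_Mapping.lookup a i \<le> c ! (i - 1)"
  show ?case
  proof (cases "a \<in> exps (Suc m)")
    case False
    then show ?thesis using artin_exps_in_exps by blast
  next
    case True
    then obtain b i where b: "b \<in> exps m" "a = b + Poly_Mapping.single (Suc m) i"
      using exps_Suc_decomp by blast
    have lk: "Poly_Mapping.lookup a l = (if l = Suc m then i else Poly_Mapping.lookup b l)" for l
      using b by (auto simp: lookup_add lookup_single when_def lookup_outside_exps)
    have snoc: "(\<forall>l \<in> {1..Suc m}. Poly_Mapping.lookup a l \<le> (c @ [z]) ! (l - 1)) \<longleftrightarrow>
        i \<le> z \<and> (\<forall>l \<in> {1..m}. Poly_Mapping.lookup b l \<le> c ! (l - 1))"
      if "length c = m" for c z
    proof -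
      have "{1..Suc m} = insert (Suc m) {1..m}" by auto
      moreover have "(c @ [z]) ! (l - 1) = c ! (l - 1)" if "l \<in> {1..m}" for l
        using that \<open>length c = m\<close> by (auto simp: nth_append)
      ultimately show ?thesis using that by (auto simp: lk nth_append)
    qed
    show ?thesis
    proof
      assume "a \<in> artin_exps (Suc m) k j"
      then have i: "i < k" "b \<in> artin_exps m k (if i < j then j - 1 else j)"
        using artin_exps_Suc_iff[OF b(1)] unfolding b(2) by blast+
      show "j \<le> Suc m \<and> a \<in> exps (Suc m) \<and> ?R (Suc m) j a"
      proof (cases "i < j")
        case lt: True
        then have jm: "j - 1 \<le> m" and "?R m (j - 1) b"
          using i(2) Suc.IH[of "j - 1" b] Suc.prems by auto
        then obtain c where c: "c \<in> shuffles [0..<j - 1] (replicate (m - (j - 1)) (k - 1))"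
          "\<forall>l \<in> {1..m}. Poly_Mapping.lookup b l \<le> c ! (l - 1)" by blast
        have len: "length c = m" using length_shuffles[OF c(1)] jm by simp
        have "[0..<j] = [0..<j - 1] @ [j - 1]" using lt by (cases j) auto
        moreover have "m - (j - 1) = Suc m - j" using lt by simp
        ultimately have "c @ [j - 1] \<in> shuffles [0..<j] (replicate (Suc m - j) (k - 1))"
          using snoc_in_shuffles_leftI[OF c(1), of "j - 1"] by simp
        moreover have "i \<le> j - 1" using lt by simp
        ultimately have "?R (Suc m) j a" using snoc[OF len, of "j - 1"] c(2) by blast
        then show ?thesis using True jm by simp
      next
        case ge: False
        then have jm: "j \<le> m" and "?R m j b"
          using i(2) Suc.IH[of j b] Suc.prems by auto
        then obtain c where c: "c \<in> shuffles [0..<j] (replicate (m - j) (k - 1))"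
          "\<forall>l \<in> {1..m}. Poly_Mapping.lookup b l \<le> c ! (l - 1)" by blast
        have len: "length c = m" using length_shuffles[OF c(1)] jm by simp
        have "replicate (Suc m - j) (k - 1) = replicate (m - j) (k - 1) @ [k - 1]"
          using jm by (simp add: Suc_diff_le replicate_append_same)
        then have "c @ [k - 1] \<in> shuffles [0..<j] (replicate (Suc m - j) (k - 1))"
          using snoc_in_shuffles_rightI[OF c(1), of "k - 1"] by simp
        moreover have "i \<le> k - 1" using i(1) by simp
        ultimately have "?R (Suc m) j a" using snoc[OF len, of "k - 1"] c(2) by blast
        then show ?thesis using True jm by simp
      qed
    next
      assume R: "j \<le> Suc m \<and> a \<in> exps (Suc m) \<and> ?R (Suc m) j a"
      then obtain d where d: "d \<in> shuffles [0..<j] (replicate (Suc m - j) (k - 1))"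
        "\<forall>l \<in> {1..Suc m}. Poly_Mapping.lookup a l \<le> d ! (l - 1)" by blast
      have "length d = Suc m" using length_shuffles[OF d(1)] R by simp
      then obtain c z where cz: "d = c @ [z]" "length c = m"
        by (metis length_append_singleton length_Suc_conv_rev)
      have c: "i \<le> z" "\<forall>l \<in> {1..m}. Poly_Mapping.lookup b l \<le> c ! (l - 1)"
        using snoc[OF cz(2)] d(2) cz(1) by auto
      consider (l) "j > 0" "z = j - 1" "c \<in> shuffles [0..<j - 1] (replicate (Suc m - j) (k - 1))"
        | (r) "j \<le> m" "z = k - 1" "c \<in> shuffles [0..<j] (replicate (m - j) (k - 1))"
      proof -
        have bl: "butlast [0..<j] = [0..<j - 1]" by (cases j) auto
        have br: "butlast (replicate (Suc m - j) (k - 1)) = replicate (m - j) (k - 1)"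
          by (simp add: butlast_conv_take)
        show thesis
          using d(1)[unfolded cz(1) snoc_in_shuffles_iff bl br] l r R
          by (auto simp del: upt.simps split: if_splits) 
      qed
      then have "i < k \<and> b \<in> artin_exps m k (if i < j then j - 1 else j)"
      proof cases
        case l
        have "m - (j - 1) = Suc m - j" using l(1) by simp
        then have "b \<in> artin_exps m k (j - 1)"
          using Suc.IH[of "j - 1" b] Suc.prems R b(1) c(2) l by auto
        then show ?thesis using c(1) l Suc.prems by auto
      next
        case r
        have "b \<in> artin_exps m k j"
          using Suc.IH[of j b] Suc.prems R b(1) c(2) r by auto
        \<comment> \<open>If the staircase ends in \<open>k - 1\<close> although
          \<open>i < j\<close>, the recursion asks for \<open>j - 1\<close> where the shorter
          staircase gives \<open>j\<close>; antitonicity closes the gap.\<close>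
        then show ?thesis using c(1) r Suc.prems artin_exps_antimono[of m k j] by auto
      qed
      then show "a \<in> artin_exps (Suc m) k j"
        using artin_exps_Suc_iff[OF b(1)] unfolding b(2) by blast
    qed
  qed
qed

lemma artin_monomials_eq:
  assumes "1 \<le> k" "k \<le> n"
  shows "artin_monomials n k = monom_of ` artin_exps n k k"
  using assms artin_exps_staircase[of k k _ n]
  unfolding artin_monomials_def staircases_def exps_def by blast

subsection \<open>Skip monomials\<close>

text \<open>Divisibility by \<open>skip_monomial S\<close>, read off from exponents.\<close>

definition dominates_skip :: "expvec \<Rightarrow> nat set \<Rightarrow> bool" where
  "dominates_skip a S \<longleftrightarrow> (\<forall>s\<in>S. s - card {t \<in> S. t < s} \<le> Poly_Mapping.lookup a s)"

text \<open>The condition at \<open>s\<close> depends only on the elements of \<open>S\<close> below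
  \<open>s\<close>, so deleting the top element leaves all others untouched. \<open>M\<close> is
  merely an upper bound, which also covers the case that it is not in \<open>S\<close>.\<close>

lemma dominates_skip_remove_Max:
  assumes "finite S" "\<And>s. s \<in> S \<Longrightarrow> s \<le> M"
  shows "dominates_skip a S \<longleftrightarrow>
    dominates_skip a (S - {M}) \<and> (M \<in> S \<longrightarrow> M - card (S - {M}) \<le> Poly_Mapping.lookup a M)"
proof -
  have "{t \<in> S. t < s} = {t \<in> S - {M}. t < s}" if "s \<in> S" for s
    using assms(2)[OF that] by auto
  moreover have "{t \<in> S. t < M} = S - {M}" using assms(2) by force
  ultimately show ?thesis unfolding dominates_skip_def by auto
qed

text \<open>Maximal elements are deleted one at a time, which preserves domination, until the
  desired size is reached.\<close>

lemma dominates_skip_subset_card: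
  assumes "finite S" "dominates_skip a S" "c \<le> card S"
  obtains S' where "S' \<subseteq> S" "card S' = c" "dominates_skip a S'"
  using assms
proof (induction "card S" arbitrary: S thesis)
  case 0
  then show ?case by (metis le_zero_eq subset_refl)
next
  case (Suc l)
  show ?case
  proof (cases "c = card S")
    case True
    then show ?thesis using Suc.prems by blast
  next
    case False
    have ne: "S \<noteq> {}" using Suc.hyps(2) by auto
    have M: "Max S \<in> S" using ne Suc.prems(2) by simp
    have l: "l = card (S - {Max S})" using Suc.hyps(2) M by simp
    have d: "dominates_skip a (S - {Max S})"
      using dominates_skip_remove_Max[of S "Max S" a] Suc.prems by auto
    have c: "c \<le> card (S - {Max S})" using False Suc.prems(4) Suc.hyps(2) l by simp
    obtain S' where "S' \<subseteq> S - {Max S}" "card S' = c" "dominates_skip a S'"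
      using Suc.hyps(1)[OF l _ _ d c] Suc.prems(2) by blast
    then show ?thesis using Suc.prems(1)[of S'] by blast
  qed
qed

lemma dominates_skip_cong:
  "(\<And>s. s \<in> S \<Longrightarrow> Poly_Mapping.lookup a s = Poly_Mapping.lookup b s) \<Longrightarrow>
    dominates_skip a S \<longleftrightarrow> dominates_skip b S"
  by (simp add: dominates_skip_def)

text \<open>The existence of a forbidden set obeys the recursion that defines
  \<open>artin_exps\<close>. The sets have size more than \<open>n - j\<close>, written without
  truncated subtraction; allowing all larger sizes makes the induction go through.\<close>

lemma artin_exps_nonskip:
  "a \<in> artin_exps n k j \<longleftrightarrow> a \<in> exps n \<and> (\<forall>i\<in>{1..n}. Poly_Mapping.lookup a i < k) \<and>
    \<not> (\<exists>S. S \<subseteq> {1..n} \<and> n < card S + j \<and> dominates_skip a S)"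
proof (induction n arbitrary: a j)
  case 0
  then show ?case by (auto simp: exps_0 dominates_skip_def)
next
  case (Suc m)
  let ?bad = "\<lambda>n j a. \<exists>S. S \<subseteq> {1..n} \<and> n < card S + j \<and> dominates_skip a S"
  show ?case
  proof (cases "a \<in> exps (Suc m)")
    case False
    then show ?thesis using artin_exps_in_exps by blast
  next
    case True
    then obtain b i where b: "b \<in> exps m" "a = b + Poly_Mapping.single (Suc m) i"
      using exps_Suc_decomp by blast
    have lk: "Poly_Mapping.lookup a l = (if l = Suc m then i else Poly_Mapping.lookup b l)" for l
      using b by (auto simp: lookup_add lookup_single when_def lookup_outside_exps)
    have dom: "dominates_skip a S \<longleftrightarrow> dominates_skip b S" if "S \<subseteq> {1..m}" for S
      using that by (intro dominates_skip_cong) (auto simp: lk)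
    have fin: "finite S" if "S \<subseteq> {1..l}" for S and l :: nat using that finite_subset by blast
    have rem: "dominates_skip a S \<longleftrightarrow> dominates_skip b (S - {Suc m}) \<and>
        (Suc m \<in> S \<longrightarrow> Suc m - card (S - {Suc m}) \<le> i)" "S - {Suc m} \<subseteq> {1..m}"
      if S: "S \<subseteq> {1..Suc m}" for S
    proof -
      show sub: "S - {Suc m} \<subseteq> {1..m}" using S by auto
      have "\<And>s. s \<in> S \<Longrightarrow> s \<le> Suc m" using S by auto
      then show "dominates_skip a S \<longleftrightarrow> dominates_skip b (S - {Suc m}) \<and>
        (Suc m \<in> S \<longrightarrow> Suc m - card (S - {Suc m}) \<le> i)"
        using dominates_skip_remove_Max[of S "Suc m" a] dom[OF sub] fin[OF S] by (simp add: lk)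
    qed
    have bad: "?bad (Suc m) j a \<longleftrightarrow> ?bad m (if i < j then j - 1 else j) b"
    proof
      assume "?bad (Suc m) j a"
      then obtain S where S: "S \<subseteq> {1..Suc m}" "Suc m < card S + j" "dominates_skip a S" by blast
      \<comment> \<open>If \<open>i < j\<close> and \<open>Suc m\<close> belongs to
        \<open>S\<close>, its own condition \<open>Suc m - card (S - {Suc m}) \<le> i\<close>
        already forces the remaining set above the bound for \<open>j - 1\<close>.\<close>
      have "m < card (S - {Suc m}) + (if i < j then j - 1 else j)"
      proof (cases "Suc m \<in> S")
        case True
        then have "Suc m - card (S - {Suc m}) \<le> i" using rem(1)[OF S(1)] S(3) by blast
        moreover have "Suc (card (S - {Suc m})) = card S"
          using True fin[OF S(1)] by (metis card_Suc_Diff1)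
        ultimately show ?thesis using S(2) by auto
      next
        case False
        then show ?thesis using S(2) by auto
      qed
      then show "?bad m (if i < j then j - 1 else j) b"
        using rem(1)[OF S(1)] rem(2)[OF S(1)] S(3) by (intro exI[of _ "S - {Suc m}"] conjI) blast+
    next
      assume "?bad m (if i < j then j - 1 else j) b"
      then obtain S where S: "S \<subseteq> {1..m}" "m < card S + (if i < j then j - 1 else j)"
        "dominates_skip b S" by blast
      have sub: "S \<subseteq> {1..Suc m}" "insert (Suc m) S \<subseteq> {1..Suc m}" using S(1) by auto
      have nin: "Suc m \<notin> S" using S(1) by auto
      show "?bad (Suc m) j a"
      proof (cases "i < j")
        case True
        then have "Suc m < card S + j" using S(2) by simp
        then show ?thesis using S(3) sub(1) dom[OF S(1)] by blast
      next
        case False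
        \<comment> \<open>Since \<open>m < card S + j\<close> and \<open>j \<le> i\<close>, the
          exponent required at \<open>Suc m\<close>, which is \<open>Suc m - card S\<close>, is at
          most \<open>i\<close>. Thus \<open>Suc m\<close> can be added to the forbidden
          set.\<close>
        have "card (insert (Suc m) S) = Suc (card S)" using nin fin[OF S(1)] by simp
        moreover have "insert (Suc m) S - {Suc m} = S" using nin by auto
        ultimately have "Suc m < card (insert (Suc m) S) + j" "dominates_skip a (insert (Suc m) S)"
          using S(2,3) False rem(1)[OF sub(2)] by simp_all
        then show ?thesis using sub(2) by blast
      qed
    qed
    have bnd: "(\<forall>l\<in>{1..Suc m}. Poly_Mapping.lookup a l < k) \<longleftrightarrow>
        i < k \<and> (\<forall>l\<in>{1..m}. Poly_Mapping.lookup b l < k)"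
    proof -
      have "{1..Suc m} = insert (Suc m) {1..m}" by auto
      then show ?thesis by (auto simp: lk)
    qed
    have "a \<in> artin_exps (Suc m) k j \<longleftrightarrow>
        i < k \<and> b \<in> artin_exps m k (if i < j then j - 1 else j)"
      unfolding b(2) by (rule artin_exps_Suc_iff[OF b(1)])
    then show ?thesis
      by (simp only: Suc.IH bad bnd b(1) True conj_assoc simp_thms)
  qed
qed

section \<open>Divisibility of monomials and comparison of exponents\<close>

lemma monom_divides_iff:
  assumes "a \<in> exps n" "e \<in> exps n"
  shows "monom_of e divides\<^bsub>QX n\<^esub> monom_of a \<longleftrightarrow>
    (\<forall>i. Poly_Mapping.lookup e i \<le> Poly_Mapping.lookup a i)"
proof
  assume "monom_of e divides\<^bsub>QX n\<^esub> monom_of a"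
  then obtain c where "monom_of a = monom_of e * c"
    by (auto simp: factor_def QX_simps)
  moreover have "a \<in> Poly_Mapping.keys (monom_of a)" by (simp add: monom_of_def)
  ultimately have "a \<in> Poly_Mapping.keys (monom_of e * c)" by simp
  then obtain b where "a = e + b"
    using Poly_Mapping.keys_mult[of "monom_of e" c] by (auto simp: monom_of_def)
  then show "\<forall>i. Poly_Mapping.lookup e i \<le> Poly_Mapping.lookup a i" by (simp add: lookup_add)
next
  assume le: "\<forall>i. Poly_Mapping.lookup e i \<le> Poly_Mapping.lookup a i"
  have "a = e + (a - e)" using le by (intro poly_mapping_eqI) (simp add: lookup_add lookup_minus)
  moreover have "Poly_Mapping.keys (a - e) \<subseteq> {1..n}"
    using assms(1) by (auto simp: exps_def in_keys_iff lookup_minus)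
  ultimately have "monom_of a = monom_of e * monom_of (a - e)" "monom_of (a - e) \<in> carrier (QX n)"
    by (simp_all add: carrier_monom flip: monom_of_add)
  then show "monom_of e divides\<^bsub>QX n\<^esub> monom_of a"
    unfolding factor_def QX_simps by blast
qed

lemma skip_monomial_divides_iff:
  assumes "S \<subseteq> {1..n}" "a \<in> exps n"
  shows "skip_monomial S divides\<^bsub>QX n\<^esub> monom_of a \<longleftrightarrow> dominates_skip a S"
proof -
  define e where "e = (\<Sum>s\<in>S. Poly_Mapping.single s (s - card {t \<in> S. t < s}))"
  have fin: "finite S" using assms(1) finite_subset by blast
  have "skip_monomial S = monom_of e"
    unfolding skip_monomial_def e_def by (simp add: monom_of_sum[OF fin] var_power)
  moreover have lk: "Poly_Mapping.lookup e i = (if i \<in> S then i - card {t \<in> S. t < i} else 0)" for i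
    unfolding e_def by (simp add: lookup_sum lookup_single when_def fin)
  moreover have "e \<in> exps n" using assms(1) by (auto simp: exps_def in_keys_iff lk split: if_splits)
  ultimately show ?thesis using assms(2) by (auto simp: monom_divides_iff dominates_skip_def)
qed

lemma var_power_divides_iff:
  assumes "i \<in> {1..n}" "a \<in> exps n"
  shows "var i ^ k divides\<^bsub>QX n\<^esub> monom_of a \<longleftrightarrow> k \<le> Poly_Mapping.lookup a i"
  using monom_divides_iff[OF assms(2) exps_single[OF assms(1), of k]]
  by (auto simp: var_power lookup_single when_def)

lemma nonskip_monomials_eq:
  assumes "1 \<le> k" "k \<le> n"
  shows "nonskip_monomials n k = monom_of ` artin_exps n k k"
proof -
  \<comment> \<open>The recursion speaks of sets of size at least \<open>n - k + 1\<close>, nonskip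
    monomials of size exactly \<open>n - k + 1\<close>; shrinking a dominated set connects the
    two.\<close>
  have bad: "(\<exists>S. S \<subseteq> {1..n} \<and> n < card S + k \<and> dominates_skip a S) \<longleftrightarrow>
      (\<exists>S. S \<subseteq> {1..n} \<and> card S = n - k + 1 \<and> dominates_skip a S)" for a
  proof
    assume "\<exists>S. S \<subseteq> {1..n} \<and> n < card S + k \<and> dominates_skip a S"
    then obtain S where S: "S \<subseteq> {1..n}" "n < card S + k" "dominates_skip a S" by blast
    have "n - k + 1 \<le> card S" using S(2) assms by simp
    then obtain S' where "S' \<subseteq> S" "card S' = n - k + 1" "dominates_skip a S'"
      using dominates_skip_subset_card[OF _ S(3)] finite_subset[OF S(1)] by blast
    then show "\<exists>S. S \<subseteq> {1..n} \<and> card S = n - k + 1 \<and> dominates_skip a S" using S(1) by blast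
  next
    assume "\<exists>S. S \<subseteq> {1..n} \<and> card S = n - k + 1 \<and> dominates_skip a S"
    moreover have "n < n - k + 1 + k" using assms by simp
    ultimately show "\<exists>S. S \<subseteq> {1..n} \<and> n < card S + k \<and> dominates_skip a S" by metis
  qed
  have iff: "monom_of a \<in> nonskip_monomials n k \<longleftrightarrow> a \<in> artin_exps n k k" if "a \<in> exps n" for a
  proof -
    have "monom_of a \<in> monomials n" using that by (auto simp: monomials_def exps_def)
    then show ?thesis
      unfolding nonskip_monomials_def artin_exps_nonskip bad mem_Collect_eq
      by (simp add: that skip_monomial_divides_iff var_power_divides_iff not_le cong: conj_cong)
        blast
  qed
  have "nonskip_monomials n k \<subseteq> monom_of ` exps n"
    unfolding nonskip_monomials_def monomials_def exps_def by blast
  then have "p \<in> nonskip_monomials n k \<longleftrightarrow> p \<in> monom_of ` artin_exps n k k" for p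
    using iff artin_exps_in_exps by (auto simp: image_iff)
  then show ?thesis by blast
qed

section \<open>Spanning modulo the ideal\<close>

text \<open>Monomial multiples of the generators, sorted by degree. The condition
  \<open>n < r + j\<close> means \<open>r > n - j\<close> without truncation: for
  \<open>j > n\<close> it admits \<open>e_0 = 1\<close>, matching the absence of Artin exponents,
  and for \<open>r > n\<close> it only adds zero.\<close>

definition gens :: "nat \<Rightarrow> nat \<Rightarrow> nat \<Rightarrow> nat \<Rightarrow> qpoly set" where
  "gens n k j d =
     {monom_of a * var i ^ k | a i. a \<in> exps n \<and> i \<in> {1..n} \<and> deg a + k = d} \<union>
     {monom_of a * elem_sym n r | a r. a \<in> exps n \<and> n < r + j \<and> deg a + r = d}"

lemma gens_varI:
  "a \<in> exps n \<Longrightarrow> i \<in> {1..n} \<Longrightarrow> deg a + k = d \<Longrightarrow> monom_of a * var i ^ k \<in> gens n k j d"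
  unfolding gens_def by blast

lemma gens_elem_symI:
  "a \<in> exps n \<Longrightarrow> n < r + j \<Longrightarrow> deg a + r = d \<Longrightarrow> monom_of a * elem_sym n r \<in> gens n k j d"
  unfolding gens_def by blast

lemma monom_var_power: "var i ^ l * monom_of a = monom_of (a + Poly_Mapping.single i l)"
  by (simp add: var_power add.commute flip: monom_of_add)

text \<open>The recurrence for elementary symmetric polynomials is iterated from
  \<open>elem_sym m (Suc m) = 0\<close>. The step from \<open>l\<close> to \<open>Suc l\<close> uses
  \<open>elem_sym (Suc m) (Suc m - l)\<close>, which is a generator exactly because
  \<open>l < j\<close>.\<close>

lemma var_power_elem_sym_in_span_gens:
  assumes "l \<le> j" "l \<le> Suc m" "a \<in> exps (Suc m)"
  shows "monom_of a * (var (Suc m) ^ l * elem_sym m (Suc m - l))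
    \<in> qv.span (gens (Suc m) k j (deg a + Suc m))"
  using assms
proof (induction l)
  case 0
  then show ?case by (simp add: elem_sym_gt qv.span_zero)
next
  case (Suc l)
  have r: "Suc m - l = Suc (Suc m - Suc l)" using Suc.prems by simp
  have "monom_of (a + Poly_Mapping.single (Suc m) l) * elem_sym (Suc m) (Suc m - l)
      \<in> gens (Suc m) k j (deg a + Suc m)"
    using Suc.prems
    by (intro gens_elem_symI exps_add exps_single) (auto simp: deg_add)
  then have 1: "monom_of a * (var (Suc m) ^ l * elem_sym (Suc m) (Suc m - l))
      \<in> qv.span (gens (Suc m) k j (deg a + Suc m))"
    by (intro qv.span_base) (simp add: mult_ac flip: monom_var_power)
  have "elem_sym (Suc m) (Suc m - l)
      = elem_sym m (Suc m - l) + var (Suc m) * elem_sym m (Suc m - Suc l)"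
    unfolding r by (rule elem_sym_Suc)
  then have "monom_of a * (var (Suc m) ^ Suc l * elem_sym m (Suc m - Suc l)) =
      monom_of a * (var (Suc m) ^ l * elem_sym (Suc m) (Suc m - l)) -
      monom_of a * (var (Suc m) ^ l * elem_sym m (Suc m - l))"
    by (simp add: algebra_simps)
  then show ?case using qv.span_diff[OF 1 Suc.IH] Suc.prems by simp
qed

text \<open>The degree is kept fixed, so that reduction modulo the generators is homogeneous; the
  later passage to lower degrees depends on this.\<close>

definition reducible :: "nat \<Rightarrow> nat \<Rightarrow> nat \<Rightarrow> nat \<Rightarrow> qpoly set" where
  "reducible n k j d =
    qv.span (monom_of ` {b \<in> artin_exps n k j. deg b = d} \<union> gens n k j d)"

lemma span_gens_reducible: "p \<in> qv.span (gens n k j d) \<Longrightarrow> p \<in> reducible n k j d"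
  unfolding reducible_def by (rule qv_span_subsetI[rotated]) (auto intro: qv.span_base)

lemma gens_reducible: "p \<in> gens n k j d \<Longrightarrow> p \<in> reducible n k j d"
  unfolding reducible_def by (intro qv.span_base) blast

text \<open>Outer induction on the number of variables, inner downward induction on the exponent
  \<open>i\<close> of the last one. The part in the first \<open>m\<close> variables is reduced
  first, then each resulting term is multiplied by the \<open>i\<close>-th power of the last
  variable.\<close>

lemma monom_of_reducible:
  "a \<in> exps n \<Longrightarrow> monom_of a \<in> reducible n k j (deg a)"
proof (induction n arbitrary: a j)
  case 0
  then have a: "a = 0" by (simp add: exps_0)
  show ?case
  proof (cases "j = 0")
    case True
    then show ?thesis unfolding a reducible_def by (intro qv.span_base) simp
  next
    case False
    \<comment> \<open>Without variables and with \<open>j > 0\<close> the generator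
      \<open>e_0 = 1\<close> reduces everything to zero.\<close>
    then have "monom_of 0 * elem_sym 0 0 \<in> gens 0 k j 0"
      by (intro gens_elem_symI) auto
    then show ?thesis using gens_reducible by (simp add: a elem_sym_0)
  qed
next
  case (Suc m)
  let ?n = "Suc m"
  \<comment> \<open>The inner induction starts at \<open>i \<ge> k\<close>, where the monomial is a
    multiple of the \<open>k\<close>-th power of the last variable.\<close>
  have last: "monom_of (b + Poly_Mapping.single ?n i) \<in> reducible ?n k j (deg b + i)"
    if "b \<in> exps m" for b i
    using that
  proof (induction "k - i" arbitrary: i b)
    case 0
    have "monom_of (b + Poly_Mapping.single ?n (i - k)) * var ?n ^ k \<in> gens ?n k j (deg b + i)"
      using 0 by (intro gens_varI exps_add exps_single) (auto simp: deg_add intro: exps_mono[of m])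
    moreover have "monom_of (b + Poly_Mapping.single ?n (i - k)) * var ?n ^ k =
        monom_of (b + Poly_Mapping.single ?n i)"
      using 0 by (simp add: mult_ac power_add[symmetric] flip: monom_var_power)
    ultimately show ?case using gens_reducible by fastforce
  next
    case (Suc l)
    have ik: "i < k" "l = k - Suc i" using Suc.hyps(2) by auto
    define j' where "j' = (if i < j then j - 1 else j)"
    have mono: "c \<in> exps ?n" if "c \<in> exps m" for c using that by (rule exps_mono[rotated]) simp
    have next_i: "monom_of (c + Poly_Mapping.single ?n (Suc i)) \<in> reducible ?n k j (deg c + Suc i)"
      if "c \<in> exps m" for c using Suc.hyps(1)[OF ik(2) that] .
    have "var ?n ^ i * x \<in> reducible ?n k j (deg b + i)"
      if x: "x \<in> monom_of ` {b' \<in> artin_exps m k j'. deg b' = deg b} \<union> gens m k j' (deg b)" for x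
    proof -
      consider (artin) b' where "x = monom_of b'" "b' \<in> artin_exps m k j'" "deg b' = deg b"
        | (var) c l where "x = monom_of c * var l ^ k" "c \<in> exps m" "l \<in> {1..m}" "deg c + k = deg b"
        | (sym) c r where "x = monom_of c * elem_sym m r" "c \<in> exps m" "m < r + j'" "deg c + r = deg b"
        using x unfolding gens_def by blast
      then show ?thesis
      proof cases
        case artin
        have "b' + Poly_Mapping.single ?n i \<in> artin_exps ?n k j"
          using artin(2) ik(1) unfolding j'_def by (rule artin_exps_SucI[rotated])
        then show ?thesis
          unfolding artin(1) monom_var_power reducible_def
          using artin(3) by (intro qv.span_base UnI1 imageI) (simp add: deg_add)
      next
        case var
        have "monom_of (c + Poly_Mapping.single ?n i) * var l ^ k \<in> gens ?n k j (deg b + i)"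
          using var by (intro gens_varI exps_add exps_single mono) (auto simp: deg_add)
        then show ?thesis
          unfolding var(1) by (intro gens_reducible) (simp add: mult_ac flip: monom_var_power)
      next
        case sym
        have gen: "var ?n ^ i * (monom_of c * elem_sym ?n r) \<in> reducible ?n k j (deg b + i)"
          if "?n < r + j"
        proof -
          have "monom_of (c + Poly_Mapping.single ?n i) * elem_sym ?n r \<in> gens ?n k j (deg b + i)"
            using sym that by (intro gens_elem_symI exps_add exps_single mono) (auto simp: deg_add)
          then show ?thesis
            by (intro gens_reducible) (simp add: mult_ac flip: monom_var_power)
        qed
        show ?thesis
        proof (cases "?n < r + j")
          case True
          show ?thesis
          proof (cases r)
            case 0
            then show ?thesis using gen[OF True] sym(1) by (simp add: elem_sym_0)
          next
            case (Suc r')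
            \<comment> \<open>The recurrence replaces \<open>elem_sym m r\<close> by the generator
              \<open>elem_sym ?n r\<close> minus \<open>var ?n * elem_sym m r'\<close>. The
              subtracted part consists of monomials with exponent \<open>Suc i\<close> of the last
              variable, which the inner induction covers.\<close>
            have "(var ?n ^ Suc i * monom_of c) * elem_sym m r' \<in> reducible ?n k j (deg b + i)"
              unfolding reducible_def
            proof (rule span_mult_image[OF elem_sym_span], fold reducible_def)
              fix y assume "y \<in> monom_of ` {a \<in> exps m. deg a = r'}"
              then obtain e where e: "y = monom_of e" "e \<in> exps m" "deg e = r'" by blast
              have "var ?n ^ Suc i * monom_of c * y = monom_of (c + e + Poly_Mapping.single ?n (Suc i))"
                unfolding e(1) mult.assoc monom_of_add[symmetric] monom_var_power[of ?n "Suc i", symmetric] ..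
              moreover have "deg (c + e) + Suc i = deg b + i"
                using sym(4) Suc e(3) by (simp add: deg_add)
              ultimately show "var ?n ^ Suc i * monom_of c * y \<in> reducible ?n k j (deg b + i)"
                using next_i[OF exps_add[OF sym(2) e(2)]] by metis
            qed
            then have "var ?n ^ i * (monom_of c * elem_sym ?n r) - var ?n ^ Suc i * monom_of c * elem_sym m r'
                \<in> reducible ?n k j (deg b + i)"
              using gen[OF True] unfolding reducible_def by (rule qv.span_diff[rotated])
            moreover have "var ?n ^ i * (monom_of c * elem_sym ?n r) -
                var ?n ^ Suc i * monom_of c * elem_sym m r' = var ?n ^ i * x"
              unfolding sym(1) Suc elem_sym_Suc by (simp add: algebra_simps)
            ultimately show ?thesis by simp
          qed
        next
          case False
          \<comment> \<open>The only remaining case is the boundary degree \<open>r = ?n - j\<close>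
            with \<open>i \<ge> j\<close>. There are enough powers of the last variable to split off
            \<open>var ?n ^ j\<close> and apply the iterated recurrence.\<close>
          then have j: "j' = j" "j \<le> i" "r = ?n - j" "j \<le> ?n"
            using sym(3) unfolding j'_def by (auto split: if_splits)
          have a: "c + Poly_Mapping.single ?n (i - j) \<in> exps ?n"
            using sym(2) by (intro exps_add exps_single mono) auto
          have "monom_of (c + Poly_Mapping.single ?n (i - j)) * (var ?n ^ j * elem_sym m r)
              = (var ?n ^ (i - j) * var ?n ^ j) * (monom_of c * elem_sym m r)"
            by (simp only: monom_var_power[symmetric] mult_ac)
          also have "\<dots> = var ?n ^ i * x"
            using j(2) by (simp add: sym(1) flip: power_add)
          finally have "var ?n ^ i * x =
              monom_of (c + Poly_Mapping.single ?n (i - j)) * (var ?n ^ j * elem_sym m r)" ..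
          moreover have "deg (c + Poly_Mapping.single ?n (i - j)) + ?n = deg b + i"
            using j sym(4) by (simp add: deg_add)
          ultimately show ?thesis
            using span_gens_reducible[OF var_power_elem_sym_in_span_gens[OF order_refl j(4) a]] j(3)
            by simp
        qed
      qed
    qed
    moreover have "monom_of b \<in> reducible m k j' (deg b)" using Suc.prems \<open>\<And>j a. a \<in> exps m \<Longrightarrow> monom_of a \<in> reducible m k j (deg a)\<close> by simp
    ultimately have "var ?n ^ i * monom_of b \<in> reducible ?n k j (deg b + i)"
      unfolding reducible_def by (rule span_mult_image[rotated])
    then show ?case by (simp only: monom_var_power)
  qed
  obtain b where "b \<in> exps m" "a = b + Poly_Mapping.single ?n (Poly_Mapping.lookup a ?n)"
    using exps_Suc_decomp[OF Suc.prems] .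
  then show ?case using last by (metis deg_add deg_single)
qed

section \<open>Evaluation at rational points\<close>

definition monom_val :: "(nat \<Rightarrow> rat) \<Rightarrow> expvec \<Rightarrow> rat" where
  "monom_val y a = (\<Prod>i\<in>Poly_Mapping.keys a. y i ^ Poly_Mapping.lookup a i)"

definition eval_at :: "(nat \<Rightarrow> rat) \<Rightarrow> qpoly \<Rightarrow> rat" where
  "eval_at y p = (\<Sum>a\<in>Poly_Mapping.keys p. Poly_Mapping.lookup p a * monom_val y a)"

lemma monom_val_superset:
  "finite A \<Longrightarrow> Poly_Mapping.keys a \<subseteq> A \<Longrightarrow>
    monom_val y a = (\<Prod>i\<in>A. y i ^ Poly_Mapping.lookup a i)"
  unfolding monom_val_def by (rule prod.mono_neutral_left) (auto simp: in_keys_iff)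

lemma monom_val_add: "monom_val y (a + b) = monom_val y a * monom_val y b"
proof -
  let ?A = "Poly_Mapping.keys a \<union> Poly_Mapping.keys b"
  have "monom_val y (a + b) = (\<Prod>i\<in>?A. y i ^ Poly_Mapping.lookup (a + b) i)"
    using Poly_Mapping.keys_add[of a b] by (intro monom_val_superset) auto
  then show ?thesis
    by (simp add: lookup_add power_add prod.distrib monom_val_superset[of ?A])
qed

lemma monom_val_0 [simp]: "monom_val y 0 = 1"
  by (simp add: monom_val_def)

lemma monom_val_single [simp]: "monom_val y (Poly_Mapping.single i m) = y i ^ m"
  by (simp add: monom_val_def)

lemma monom_val_fun_upd:
  "a \<in> exps m \<Longrightarrow> monom_val (y(Suc m := z)) a = monom_val y a"
  unfolding monom_val_def exps_def by (intro prod.cong) auto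

lemma eval_at_superset:
  "finite A \<Longrightarrow> Poly_Mapping.keys p \<subseteq> A \<Longrightarrow>
    eval_at y p = (\<Sum>a\<in>A. Poly_Mapping.lookup p a * monom_val y a)"
  unfolding eval_at_def by (rule sum.mono_neutral_left) (auto simp: in_keys_iff)

lemma eval_at_0 [simp]: "eval_at y 0 = 0"
  by (simp add: eval_at_def)

lemma eval_at_monom [simp]: "eval_at y (monom_of a) = monom_val y a"
  by (simp add: eval_at_def monom_of_def)

lemma eval_at_add: "eval_at y (p + q) = eval_at y p + eval_at y q"
proof -
  let ?A = "Poly_Mapping.keys p \<union> Poly_Mapping.keys q"
  have "eval_at y (p + q) = (\<Sum>a\<in>?A. Poly_Mapping.lookup (p + q) a * monom_val y a)"
    using Poly_Mapping.keys_add[of p q] by (intro eval_at_superset) auto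
  then show ?thesis
    by (simp add: lookup_add distrib_right sum.distrib eval_at_superset[of ?A])
qed

lemma eval_at_const_mult: "eval_at y (const_poly c * p) = c * eval_at y p"
proof -
  have "eval_at y (const_poly c * p) =
      (\<Sum>a\<in>Poly_Mapping.keys p. Poly_Mapping.lookup (const_poly c * p) a * monom_val y a)"
    by (intro eval_at_superset) (auto simp: in_keys_iff lookup_const_mult)
  then show ?thesis
    by (simp add: lookup_const_mult eval_at_def sum_distrib_left mult.assoc)
qed

lemma eval_at_uminus: "eval_at y (- p) = - eval_at y p"
  using eval_at_add[of y p "- p"] by simp

lemma eval_at_diff: "eval_at y (p - q) = eval_at y p - eval_at y q"
  using eval_at_add[of y p "- q"] by (simp add: eval_at_uminus)

lemma eval_at_sum: "eval_at y (sum f A) = (\<Sum>x\<in>A. eval_at y (f x))"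
  by (induction A rule: infinite_finite_induct) (simp_all add: eval_at_add)

text \<open>Both sides are linear in \<open>p\<close>, so it suffices that \<open>monom_val\<close>
  is multiplicative.\<close>

lemma eval_at_monom_mult: "eval_at y (monom_of a * p) = monom_val y a * eval_at y p"
proof -
  have "p \<in> qv.span (monom_of ` UNIV)" by (rule in_span_monomials) simp
  then show ?thesis
  proof (induction rule: qv.span_induct_alt)
    case (step c x q)
    then obtain b where "x = monom_of b" by blast
    moreover have "monom_of a * (const_poly c * monom_of b + q) =
        const_poly c * monom_of (a + b) + monom_of a * q"
      by (simp add: monom_of_add algebra_simps)
    ultimately show ?case
      by (simp only: eval_at_add eval_at_const_mult eval_at_monom monom_val_add step(2))
        (simp add: algebra_simps)
  qed simp
qed

lemma eval_at_elem_sym: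
  "eval_at y (elem_sym n d) = (\<Sum>S | S \<subseteq> {1..n} \<and> card S = d. \<Prod>i\<in>S. y i)"
proof -
  have "monom_val y (\<Sum>i\<in>S. Poly_Mapping.single i 1) = (\<Prod>i\<in>S. y i)" for S
    by (induction S rule: infinite_finite_induct) (simp_all add: monom_val_add)
  then show ?thesis by (simp add: elem_sym_monom eval_at_sum)
qed

text \<open>The product is expanded over subsets, which are then grouped by size. Taking
  \<open>- z\<close> to be a coordinate of \<open>y\<close> makes the right side zero, which yields
  linear relations among the values of the \<open>e_d\<close>.\<close>

lemma eval_at_elem_sym_generating:
  "(\<Sum>d\<le>n. z ^ (n - d) * eval_at y (elem_sym n d)) = (\<Prod>i\<in>{1..n}. y i + z)"
proof -
  have "(\<Prod>i\<in>{1..n}. y i + z) = (\<Sum>S\<in>Pow {1..n}. (\<Prod>i\<in>S. y i) * (\<Prod>i\<in>{1..n} - S. z))"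
    by (rule prod_add) simp
  also have "\<dots> = (\<Sum>S\<in>Pow {1..n}. (\<Prod>i\<in>S. y i) * z ^ (n - card S))"
    by (intro sum.cong refl) (auto simp: card_Diff_subset finite_subset)
  also have "\<dots> = (\<Sum>d\<le>n. \<Sum>S | S \<in> Pow {1..n} \<and> card S = d. (\<Prod>i\<in>S. y i) * z ^ (n - card S))"
  proof (rule sum.group[symmetric])
    show "card ` Pow {1..n} \<subseteq> {..n}"
      using card_mono[of "{1..n}"] by auto
  qed auto
  also have "\<dots> = (\<Sum>d\<le>n. z ^ (n - d) * eval_at y (elem_sym n d))"
    by (simp add: eval_at_elem_sym sum_distrib_left mult.commute)
  finally show ?thesis ..
qed

section \<open>Vandermonde systems\<close>

text \<open>A polynomial of degree below \<open>m\<close> with coefficients \<open>f\<close> has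
  \<open>m\<close> distinct roots.\<close>

lemma vandermonde_zero:
  fixes f :: "nat \<Rightarrow> rat"
  assumes "finite S" "card S = m" "\<And>z. z \<in> S \<Longrightarrow> (\<Sum>i<m. z ^ i * f i) = 0" "i < m"
  shows "f i = 0"
proof -
  define p where "p = (\<Sum>i<m. Polynomial.monom (f i) i)"
  have "Polynomial.degree p < card S"
    unfolding p_def assms(2) using assms(4)
    by (intro degree_sum_less) (auto intro: le_less_trans[OF degree_monom_le])
  moreover have "poly p z = poly 0 z" if "z \<in> S" for z
    using assms(3)[OF that] by (simp add: p_def poly_sum poly_monom mult.commute)
  ultimately have "p = 0" using poly_eqI_degree[of S p 0] by fastforce
  then have "Polynomial.coeff p i = 0" by simp
  then show ?thesis using assms(4) by (simp add: p_def coeff_sum)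
qed

text \<open>The weights are the coefficients of the Lagrange basis polynomials.\<close>

lemma vandermonde_dual:
  fixes S :: "rat set"
  assumes "finite S" "u\<^sub>0 < card S"
  obtains w where "\<And>u. u < card S \<Longrightarrow> (\<Sum>z\<in>S. w z * z ^ u) = (if u = u\<^sub>0 then 1 else 0)"
proof
  define L where "L z = Polynomial.smult (1 / (\<Prod>t\<in>S - {z}. z - t)) (\<Prod>t\<in>S - {z}. [:- t, 1:])" for z
  have poly_L: "poly (L z) x = (if x = z then 1 else 0)" if "z \<in> S" "x \<in> S" for z x
    using that assms(1) by (auto simp: L_def poly_prod)
  have deg_L: "Polynomial.degree (L z) < card S" if "z \<in> S" for z
  proof -
    have "Polynomial.degree (\<Prod>t\<in>S - {z}. [:- t, 1:]) \<le> card (S - {z})"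
      using degree_prod_sum_le[of "S - {z}" "\<lambda>t. [:- t, 1:]"] assms(1) by simp
    then have "Polynomial.degree (L z) \<le> card (S - {z})"
      unfolding L_def by (meson degree_smult_le le_trans)
    then show ?thesis using card_Diff1_less[OF assms(1) that] by simp
  qed
  fix u assume u: "u < card S"
  \<comment> \<open>The Lagrange interpolation of the \<open>u\<close>-th power is that power
    itself; the claim compares coefficients at \<open>u\<^sub>0\<close>.\<close>
  define p where "p = (\<Sum>z\<in>S. Polynomial.smult (z ^ u) (L z))"
  have "p = Polynomial.monom 1 u"
  proof (rule poly_eqI_degree)
    fix x assume x: "x \<in> S"
    have "poly p x = (\<Sum>z\<in>S. if x = z then z ^ u else 0)"
      unfolding p_def poly_sum by (intro sum.cong) (auto simp: poly_L x)
    then show "poly p x = poly (Polynomial.monom 1 u) x"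
      using x assms(1) by (simp add: poly_monom)
  next
    show "Polynomial.degree p < card S"
      unfolding p_def using u deg_L
      by (intro degree_sum_less) (auto intro: le_less_trans[OF degree_smult_le])
    show "Polynomial.degree (Polynomial.monom (1::rat) u) < card S"
      using u by (simp add: degree_monom_eq)
  qed
  then have "Polynomial.coeff p u\<^sub>0 = (if u = u\<^sub>0 then 1 else 0)" by simp
  then show "(\<Sum>z\<in>S. Polynomial.coeff (L z) u\<^sub>0 * z ^ u) = (if u = u\<^sub>0 then 1 else 0)"
    by (simp add: p_def coeff_sum mult.commute)
qed

section \<open>Independence on a finite point set\<close>

text \<open>Points are total functions on the naturals, so that appending a coordinate is a function
  update.\<close>

definition words :: "nat \<Rightarrow> rat set \<Rightarrow> rat set \<Rightarrow> (nat \<Rightarrow> rat) set" where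
  "words n V T = {y. y ` {1..n} \<subseteq> V \<and> T \<subseteq> y ` {1..n}}"

lemma words_Suc:
  assumes "y \<in> words m V T" "z \<in> V"
  shows "y(Suc m := z) \<in> words (Suc m) V (insert z T)"
proof -
  have "{1..Suc m} = insert (Suc m) {1..m}" by auto
  moreover have "y(Suc m := z) ` {1..m} = y ` {1..m}" by (intro image_cong) auto
  ultimately have eq: "y(Suc m := z) ` {1..Suc m} = insert z (y ` {1..m})"
    by (simp only: image_insert fun_upd_same)
  show ?thesis using assms unfolding words_def mem_Collect_eq eq by (simp add: subset_insertI2)
qed

lemma words_mono: "y \<in> words n V T \<Longrightarrow> T' \<subseteq> T \<Longrightarrow> y \<in> words n V T'"
  unfolding words_def by (simp add: order_trans[of T' T])

text \<open>Grouping by the exponent \<open>i\<close> of the last variable turns the relation into a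
  polynomial in the last coordinate with coefficients \<open>F i y\<close>. Coefficients with
  \<open>i \<ge> j\<close> are eliminated first, by varying that coordinate over \<open>V\<close>;
  those with \<open>i < j\<close> follow by varying it over \<open>T\<close>.\<close>

lemma artin_exps_independent:
  assumes "finite V" "T \<subseteq> V"
    and "\<And>y. y \<in> words n V T \<Longrightarrow>
      (\<Sum>b\<in>artin_exps n (card V) (card T). c b * monom_val y b) = 0"
    and "b \<in> artin_exps n (card V) (card T)"
  shows "c b = 0"
  using assms(2-4)
proof (induction n arbitrary: T c b)
  case 0
  have "T = {}" "b = 0"
    using 0(3) finite_subset[OF 0(1) assms(1)] by (auto split: if_splits)
  then show ?case using 0(2)[of "\<lambda>_. 0"] by (simp add: words_def)
next
  case (Suc m)
  define k j where "k = card V" and "j = card T"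
  have jk: "j \<le> k" using card_mono[OF assms(1) Suc.prems(1)] by (simp add: k_def j_def)
  have finT: "finite T" using finite_subset[OF Suc.prems(1) assms(1)] .
  define B where "B i = artin_exps m k (if i < j then j - 1 else j)" for i
  define ex where "ex b i = b + Poly_Mapping.single (Suc m) i" for b :: expvec and i
  define F where "F i y = (\<Sum>b\<in>B i. c (ex b i) * monom_val y b)" for i y
  have B_exps: "b \<in> exps m" if "b \<in> B i" for b i
    using that unfolding B_def by (rule artin_exps_in_exps)
  have finB: "finite (B i)" for i unfolding B_def by (rule finite_artin_exps)
  have split: "(\<Sum>b\<in>artin_exps (Suc m) k j. c b * monom_val y b) = (\<Sum>i<k. y (Suc m) ^ i * F i y)" for y
  proof -
    have eq: "artin_exps (Suc m) k j = (\<Union>i<k. (\<lambda>b. ex b i) ` B i)"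
      unfolding artin_exps.simps B_def ex_def by blast
    have inj: "inj_on (\<lambda>b. ex b i) (B i)" for i
      by (rule inj_onI) (simp add: ex_def)
    have "(\<Sum>b\<in>artin_exps (Suc m) k j. c b * monom_val y b)
        = (\<Sum>i<k. \<Sum>b\<in>(\<lambda>b. ex b i) ` B i. c b * monom_val y b)"
      unfolding eq
    proof (rule sum.UNION_disjoint)
      show "\<forall>i\<in>{..<k}. \<forall>i'\<in>{..<k}. i \<noteq> i' \<longrightarrow> (\<lambda>b. ex b i) ` B i \<inter> (\<lambda>b. ex b i') ` B i' = {}"
      proof (intro ballI impI equals0I)
        fix i i' a assume ii: "i \<noteq> i'" and "a \<in> (\<lambda>b. ex b i) ` B i \<inter> (\<lambda>b. ex b i') ` B i'"
        then obtain b b' where "ex b i = ex b' i'" "b \<in> B i" "b' \<in> B i'" by auto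
        then show False using exps_Suc_inj[of b m b' i i'] B_exps ii unfolding ex_def by blast
      qed
    qed (simp_all add: finB)
    also have "\<dots> = (\<Sum>i<k. \<Sum>b\<in>B i. c (ex b i) * monom_val y (ex b i))"
      by (simp add: sum.reindex[OF inj])
    also have "\<dots> = (\<Sum>i<k. y (Suc m) ^ i * F i y)"
      by (simp add: F_def ex_def monom_val_add sum_distrib_left mult_ac)
    finally show ?thesis .
  qed
  have F_upd: "F i (y(Suc m := z)) = F i y" for i y z
    unfolding F_def by (intro sum.cong refl) (simp add: monom_val_fun_upd B_exps)
  have vanish: "(\<Sum>i<k. z ^ i * F i y) = 0" if "y \<in> words m V T'" "z \<in> V" "T \<subseteq> insert z T'" for y z T'
    using Suc.prems(2)[OF words_mono[OF words_Suc[OF that(1,2)] that(3)]]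
    unfolding k_def[symmetric] j_def[symmetric] split by (simp add: F_upd)
  \<comment> \<open>If the first \<open>m\<close> coordinates already cover \<open>T\<close>, the
    last one runs freely over the \<open>k\<close> points of \<open>V\<close>, enough to separate
    all \<open>k\<close> exponents.\<close>
  have F0: "F i y = 0" if "y \<in> words m V T" "i < k" for i y
  proof (rule vandermonde_zero[OF assms(1) k_def[symmetric] _ that(2)])
    fix z assume "z \<in> V"
    then show "(\<Sum>i<k. z ^ i * F i y) = 0" using vanish[OF that(1)] by blast
  qed
  have high: "c (ex b i) = 0" if "j \<le> i" "i < k" "b \<in> B i" for b i
  proof (rule Suc.IH[OF Suc.prems(1), of "\<lambda>b. c (ex b i)" b])
    have Bi: "B i = artin_exps m (card V) (card T)" using that(1) by (simp add: B_def k_def j_def)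
    then show "b \<in> artin_exps m (card V) (card T)" using that(3) by simp
    show "(\<Sum>b\<in>artin_exps m (card V) (card T). c (ex b i) * monom_val y b) = 0"
      if "y \<in> words m V T" for y
      using F0[OF that \<open>i < k\<close>] unfolding F_def Bi .
  qed
  have F_high: "F i y = 0" if "j \<le> i" "i < k" for i y
    unfolding F_def using high that by simp
  have low: "c (ex b i) = 0" if "i < j" "b \<in> B i" for b i
  proof -
    \<comment> \<open>For fixed \<open>b\<close> this is a Vandermonde system with the
      \<open>j\<close> elements of \<open>T\<close> as nodes. Each equation is the induction
      hypothesis for \<open>T - {z}\<close>, applied to the combined coefficients.\<close>
    have "(\<Sum>i<j. z ^ i * c (ex b i)) = 0" if z: "z \<in> T" for z
    proof (rule Suc.IH[of "T - {z}" "\<lambda>b. \<Sum>i<j. z ^ i * c (ex b i)" b])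
      have card: "card (T - {z}) = j - 1" using z finT by (simp add: j_def)
      show "T - {z} \<subseteq> V" using Suc.prems(1) by blast
      show "b \<in> artin_exps m (card V) (card (T - {z}))"
        using \<open>b \<in> B i\<close> \<open>i < j\<close> by (simp add: card B_def flip: k_def)
      fix y assume y: "y \<in> words m V (T - {z})"
      \<comment> \<open>With \<open>z\<close> as last coordinate the others need only cover
        \<open>T - {z}\<close>. The terms with \<open>i \<ge> j\<close> have vanished, and for
        \<open>i < j\<close> all \<open>B i\<close> are the same set, so the sums can be
        exchanged.\<close>
      have "(\<Sum>i<k. z ^ i * F i y) = (\<Sum>i<j. z ^ i * F i y)"
        using jk F_high by (intro sum.mono_neutral_right) auto
      also have "\<dots> = (\<Sum>b\<in>artin_exps m k (j - 1). (\<Sum>i<j. z ^ i * c (ex b i)) * monom_val y b)"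
        by (subst sum_distrib_right, subst sum.swap)
          (simp add: F_def B_def sum_distrib_left mult.assoc)
      finally show "(\<Sum>b\<in>artin_exps m (card V) (card (T - {z})).
          (\<Sum>i<j. z ^ i * c (ex b i)) * monom_val y b) = 0"
        unfolding card k_def[symmetric] using vanish[OF y, of z] z Suc.prems(1) by auto
    qed
    then show ?thesis
      by (rule vandermonde_zero[OF finT j_def[symmetric] _ that(1)])
  qed
  have "b \<in> {b + Poly_Mapping.single (Suc m) i | b i. i < k \<and> b \<in> B i}"
    using Suc.prems(3) unfolding artin_exps.simps B_def k_def j_def .
  then obtain b' i where "b = ex b' i" "i < k" "b' \<in> B i"
    unfolding ex_def by blast
  then show ?case using low high by (cases "i < j") auto
qed

section \<open>Deformation of the ideal to a point set\<close>

definition vanishing :: "nat \<Rightarrow> rat set \<Rightarrow> rat set \<Rightarrow> qpoly set" where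
  "vanishing n V T = {p. \<forall>y\<in>words n V T. eval_at y p = 0}"

lemma subspace_vanishing: "qv.subspace (vanishing n V T)"
  by (rule qv.subspaceI) (simp_all add: vanishing_def eval_at_add eval_at_const_mult)

text \<open>Approximation by \<open>qv.span G\<close> modulo a subspace \<open>Z\<close> is
  preserved by linear combinations.\<close>

lemma span_mod_subspace:
  assumes "qv.subspace Z" "\<And>x. x \<in> A \<Longrightarrow> \<exists>g\<in>qv.span G. x - g \<in> Z" "p \<in> qv.span A"
  shows "\<exists>g\<in>qv.span G. p - g \<in> Z"
  using assms(3)
proof (induction rule: qv.span_induct_alt)
  case base
  then show ?case using qv.subspace_0[OF assms(1)] by (intro bexI[of _ 0]) (auto simp: qv.span_zero)
next
  case (step c x q)
  then obtain g h where gh: "g \<in> qv.span G" "x - g \<in> Z" "h \<in> qv.span G" "q - h \<in> Z"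
    using assms(2) by blast
  have "const_poly c * x + q - (const_poly c * g + h) = const_poly c * (x - g) + (q - h)"
    by (simp add: algebra_simps)
  also have "\<dots> \<in> Z"
    using gh assms(1) by (intro qv.subspace_add qv.subspace_scale)
  finally show ?case
    using gh by (intro bexI[of _ "const_poly c * g + h"]) (auto intro: qv.span_add qv.span_scale)
qed

lemma monom_mult_elem_sym_span:
  assumes "a \<in> exps n" "deg a + s = d"
  shows "monom_of a * elem_sym n s \<in> qv.span (monom_of ` {b \<in> exps n. deg b = d})"
proof (rule span_mult_image[OF elem_sym_span])
  fix x assume "x \<in> monom_of ` {a \<in> exps n. deg a = s}"
  then obtain e where "x = monom_of e" "e \<in> exps n" "deg e = s" by blast
  then show "monom_of a * x \<in> qv.span (monom_of ` {b \<in> exps n. deg b = d})"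
    using assms by (intro qv.span_base) (auto simp: deg_add exps_add simp flip: monom_of_add)
qed

text \<open>On words in \<open>V\<close>, the power \<open>x\<^sub>i\<^sup>k\<close> is corrected to \<open>\<Prod>\<^bsub>z \<in> V\<^esub> (x\<^sub>i - z)\<close>.  On words containing
  \<open>T\<close>, all products \<open>\<Prod>\<^sub>i (x\<^sub>i - z)\<close> with \<open>z \<in> T\<close> vanish; they are combinations of the \<open>e\<^sub>s\<close> with
  Vandermonde coefficients, so a suitable combination of them has a prescribed leading \<open>e\<^sub>r\<close>.\<close>

lemma gens_deform:
  assumes "finite V" "T \<subseteq> V" "p \<in> gens n (card V) (card T) d"
  shows "\<exists>g\<in>qv.span (monom_of ` {a \<in> exps n. deg a < d}). p - g \<in> vanishing n V T"
proof -
  let ?low = "qv.span (monom_of ` {a \<in> exps n. deg a < d})"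
  consider (var) a i where "p = monom_of a * var i ^ card V" "a \<in> exps n" "i \<in> {1..n}" "deg a + card V = d"
    | (sym) a r where "p = monom_of a * elem_sym n r" "a \<in> exps n" "n < r + card T" "deg a + r = d"
    using assms(3) unfolding gens_def by blast
  then show ?thesis
  proof cases
    case var
    define q where "q = (\<Prod>z\<in>V. [:- z, 1:])"
    have dq: "Polynomial.degree q = card V"
      unfolding q_def by (subst degree_prod_eq_sum_degree) auto
    have lq: "Polynomial.coeff q (card V) = 1"
      using lead_coeff_prod[of "\<lambda>z. [:- z, 1:]" V] dq by (simp add: q_def)
    define g where "g = (\<Sum>u<card V. const_poly (- Polynomial.coeff q u) * monom_of (a + Poly_Mapping.single i u))"
    have "g \<in> ?low"
      unfolding g_def using var
      by (intro qv.span_sum qv.span_scale qv.span_base imageI) (auto simp: deg_add intro!: exps_add exps_single)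
    moreover have "eval_at y (p - g) = 0" if "y \<in> words n V T" for y
    proof -
      have "eval_at y g = - (monom_val y a * (\<Sum>u<card V. Polynomial.coeff q u * y i ^ u))"
        unfolding g_def eval_at_sum eval_at_const_mult eval_at_monom monom_val_add monom_val_single
        by (simp add: sum_distrib_left sum_negf mult_ac)
      then have "eval_at y (p - g) = monom_val y a *
          ((\<Sum>u<card V. Polynomial.coeff q u * y i ^ u) + y i ^ card V)"
        unfolding var(1) eval_at_diff var_power eval_at_monom_mult eval_at_monom monom_val_single
        by (simp only: distrib_left diff_minus_eq_add add.commute)
      also have "(\<Sum>u<card V. Polynomial.coeff q u * y i ^ u) + y i ^ card V = poly q (y i)"
        unfolding poly_altdef dq by (simp add: lq flip: lessThan_Suc_atMost)
      also have "poly q (y i) = 0"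
        using that var(3) assms(1) by (force simp: q_def poly_prod words_def)
      finally show ?thesis by simp
    qed
    ultimately show ?thesis by (auto simp: vanishing_def)
  next
    case sym
    have finT: "finite T" using assms finite_subset by blast
    show ?thesis
    proof (cases "r \<le> n")
      case False
      then have "p = 0" using sym(1) by (simp add: elem_sym_gt)
      then show ?thesis
        by (intro bexI[of _ 0]) (simp_all add: vanishing_def qv.span_zero)
    next
      case True
      \<comment> \<open>The sign turns the factors \<open>y i + z\<close> of the generating identity
        into differences of coordinates and elements of \<open>T\<close>.\<close>
      define S where "S = uminus ` T"
      have S: "finite S" "card S = card T"
        using finT unfolding S_def by (auto intro: card_image inj_onI)
      have "n - r < card S" using sym(3) True S(2) by simp
      then obtain w where w: "\<And>u. u < card S \<Longrightarrow> (\<Sum>z\<in>S. w z * z ^ u) = (if u = n - r then 1 else 0)"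
        using vandermonde_dual[OF S(1)] by blast
      \<comment> \<open>These are the coefficients of the \<open>e_s\<close> after the generating
        identities are combined with weights \<open>w\<close>. The dual Vandermonde property makes
        them \<open>1\<close> at \<open>s = r\<close> and \<open>0\<close> at every other
        \<open>s \<le> n\<close> with \<open>n < s + card T\<close>.\<close>
      define \<kappa> where "\<kappa> s = (\<Sum>z\<in>S. w z * z ^ (n - s))" for s
      have \<kappa>: "\<kappa> s = (if s = r then 1 else 0)" if "s \<le> n" "n < s + card T" for s
      proof -
        have "n - s < card S" using that S(2) by simp
        moreover have "n - s = n - r \<longleftrightarrow> s = r" using that True by auto
        ultimately show ?thesis unfolding \<kappa>_def using w by simp
      qed
      \<comment> \<open>What remains of the combination has \<open>s \<le> n - card T < r\<close>,
        hence lower degree than \<open>p\<close>.\<close>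
      define g where "g = (\<Sum>s\<in>{s. s + card T \<le> n}. const_poly (- \<kappa> s) * (monom_of a * elem_sym n s))"
      have "g \<in> ?low"
        unfolding g_def
      proof (intro qv.span_sum qv.span_scale)
        fix s assume s: "s \<in> {s. s + card T \<le> n}"
        have "monom_of ` {b \<in> exps n. deg b = deg a + s} \<subseteq> monom_of ` {a \<in> exps n. deg a < d}"
          using s sym by (intro image_mono) auto
        then show "monom_of a * elem_sym n s \<in> ?low"
          using monom_mult_elem_sym_span[OF sym(2) refl, of s] qv.span_mono by blast
      qed
      moreover have "eval_at y (p - g) = 0" if y: "y \<in> words n V T" for y
      proof -
        let ?e = "\<lambda>s. eval_at y (elem_sym n s)"
        have un: "{..n} = {s. s + card T \<le> n} \<union> {s. s \<le> n \<and> n < s + card T}" by auto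
        have "(\<Sum>s\<le>n. \<kappa> s * ?e s) = (\<Sum>s | s + card T \<le> n. \<kappa> s * ?e s)
            + (\<Sum>s | s \<le> n \<and> n < s + card T. \<kappa> s * ?e s)"
          unfolding un by (rule sum.union_disjoint) (auto intro: finite_subset[of _ "{..n}"])
        also have "(\<Sum>s | s \<le> n \<and> n < s + card T. \<kappa> s * ?e s)
            = (\<Sum>s | s \<le> n \<and> n < s + card T. if s = r then ?e r else 0)"
          by (intro sum.cong) (auto simp: \<kappa>)
        also have "\<dots> = ?e r" using True sym(3) by simp
        finally have 1: "(\<Sum>s\<le>n. \<kappa> s * ?e s) = (\<Sum>s | s + card T \<le> n. \<kappa> s * ?e s) + ?e r" .
        have "(\<Sum>s\<le>n. \<kappa> s * ?e s) = (\<Sum>z\<in>S. w z * (\<Sum>s\<le>n. z ^ (n - s) * ?e s))"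
          unfolding \<kappa>_def sum_distrib_right sum_distrib_left
          by (subst sum.swap) (simp add: mult_ac)
        also have "\<dots> = (\<Sum>z\<in>S. w z * (\<Prod>i\<in>{1..n}. y i + z))"
          by (simp only: eval_at_elem_sym_generating)
        also have "\<dots> = 0"
        proof (intro sum.neutral ballI)
          fix z assume "z \<in> S"
          then have "- z \<in> y ` {1..n}" using y unfolding S_def words_def by auto
          then obtain i where "i \<in> {1..n}" "y i + z = 0" by (metis add.left_inverse imageE)
          then have "(\<Prod>i\<in>{1..n}. y i + z) = 0" by (intro prod_zero) auto
          then show "w z * (\<Prod>i\<in>{1..n}. y i + z) = 0" by simp
        qed
        finally have 2: "(\<Sum>s\<le>n. \<kappa> s * ?e s) = 0" .
        have "eval_at y g = - (monom_val y a * (\<Sum>s | s + card T \<le> n. \<kappa> s * ?e s))"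
          unfolding g_def eval_at_sum eval_at_const_mult eval_at_monom_mult
          by (simp add: sum_distrib_left sum_negf mult_ac)
        then have "eval_at y (p - g) = monom_val y a * ((\<Sum>s | s + card T \<le> n. \<kappa> s * ?e s) + ?e r)"
          unfolding sym(1) eval_at_diff eval_at_monom_mult
          by (simp only: distrib_left diff_minus_eq_add add.commute)
        then show ?thesis using 1 2 by simp
      qed
      ultimately show ?thesis by (auto simp: vanishing_def)
    qed
  qed
qed

text \<open>A monomial is reduced within its own degree to Artin monomials and generators. On the
  point set the generators agree with polynomials of lower degree, which the induction hypothesis
  handles.\<close>

lemma reduce_lower:
  assumes "finite V" "T \<subseteq> V"
  shows "g \<in> qv.span (monom_of ` {a \<in> exps n. deg a < d}) \<Longrightarrow>
    \<exists>r\<in>qv.span (monom_of ` {b \<in> artin_exps n (card V) (card T). deg b < d}). g - r \<in> vanishing n V T"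
proof (induction d arbitrary: g)
  case 0
  then show ?case using qv.subspace_0[OF subspace_vanishing] by simp
next
  case (Suc d)
  let ?B = "artin_exps n (card V) (card T)"
  let ?R = "\<lambda>d. qv.span (monom_of ` {b \<in> ?B. deg b < d})"
  show ?case
  proof (rule span_mod_subspace[OF subspace_vanishing _ Suc.prems])
    fix x assume "x \<in> monom_of ` {a \<in> exps n. deg a < Suc d}"
    then obtain a where a: "x = monom_of a" "a \<in> exps n" "deg a \<le> d" by (auto simp: less_Suc_eq_le)
    obtain r q where rq: "x = r + q" "r \<in> qv.span (monom_of ` {b \<in> ?B. deg b = deg a})"
      "q \<in> qv.span (gens n (card V) (card T) (deg a))"
      using monom_of_reducible[OF a(2), of "card V" "card T"]
      unfolding reducible_def qv.span_Un a(1) by blast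
    obtain h where h: "h \<in> qv.span (monom_of ` {a' \<in> exps n. deg a' < deg a})" "q - h \<in> vanishing n V T"
      using span_mod_subspace[OF subspace_vanishing gens_deform[OF assms] rq(3)] by blast
    have "monom_of ` {a' \<in> exps n. deg a' < deg a} \<subseteq> monom_of ` {a' \<in> exps n. deg a' < d}"
      using a(3) by (intro image_mono) auto
    then obtain s where s: "s \<in> ?R d" "h - s \<in> vanishing n V T"
      using Suc.IH h(1) qv.span_mono by blast
    have "monom_of ` {b \<in> ?B. deg b < d} \<subseteq> monom_of ` {b \<in> ?B. deg b < Suc d}"
      "monom_of ` {b \<in> ?B. deg b = deg a} \<subseteq> monom_of ` {b \<in> ?B. deg b < Suc d}"
      using a(3) by (intro image_mono; auto)+
    then have "s \<in> ?R (Suc d)" "r \<in> ?R (Suc d)"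
      using s(1) rq(2) qv.span_mono by blast+
    then have "r + s \<in> ?R (Suc d)" by (rule qv.span_add[rotated])
    moreover have "x - (r + s) \<in> vanishing n V T"
      using qv.subspace_add[OF subspace_vanishing h(2) s(2)] by (simp add: rq(1))
    ultimately show "\<exists>g\<in>?R (Suc d). x - g \<in> vanishing n V T" by blast
  qed
qed

section \<open>Homogeneous components\<close>

definition hom_part :: "nat \<Rightarrow> qpoly \<Rightarrow> qpoly" where
  "hom_part d p = Poly_Mapping.mapp (\<lambda>a c. if deg a = d then c else 0) p"

lemma lookup_hom_part:
  "Poly_Mapping.lookup (hom_part d p) a = (if deg a = d then Poly_Mapping.lookup p a else 0)"
  by (simp add: hom_part_def lookup_mapp when_def in_keys_iff)

lemma hom_part_gens:
  assumes "x \<in> gens n k j e"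
  shows "hom_part d x = (if d = e then x else 0)"
proof -
  have "x \<in> qv.span (monom_of ` {b \<in> exps n. deg b = e})"
    using assms unfolding gens_def
  proof (elim UnE CollectE exE conjE)
    fix a i assume "x = monom_of a * var i ^ k" "a \<in> exps n" "i \<in> {1..n}" "deg a + k = e"
    then show ?thesis
      by (intro qv.span_base)
        (auto simp: var_power deg_add intro!: exps_add exps_single simp flip: monom_of_add)
  qed (simp add: monom_mult_elem_sym_span)
  then have "deg a = e" if "Poly_Mapping.lookup x a \<noteq> 0" for a
    using span_monomials_keys that by (fastforce simp: in_keys_iff)
  then show ?thesis by (intro poly_mapping_eqI) (auto simp: lookup_hom_part)
qed

text \<open>The generators are homogeneous, so taking the component of degree \<open>d\<close> keeps
  those of degree \<open>d\<close> and kills the others.\<close>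

lemma hom_part_span_gens:
  assumes "p \<in> qv.span (\<Union>e. gens n k j e)"
  shows "hom_part d p \<in> qv.span (gens n k j d)"
  using assms
proof (induction rule: qv.span_induct_alt)
  case base
  have "hom_part d 0 = 0" by (intro poly_mapping_eqI) (simp add: lookup_hom_part)
  then show ?case by (simp add: qv.span_zero)
next
  case (step c x q)
  then obtain e where e: "x \<in> gens n k j e" by blast
  have "hom_part d (const_poly c * x + q) = const_poly c * hom_part d x + hom_part d q"
    by (intro poly_mapping_eqI) (simp add: lookup_hom_part lookup_add lookup_const_mult)
  moreover have "hom_part d x \<in> qv.span (gens n k j d)"
    using e hom_part_gens[OF e] by (auto intro: qv.span_base qv.span_zero)
  ultimately show ?case using step(2) by (simp add: qv.span_add qv.span_scale)
qed

text \<open>To see that the coefficient at \<open>b\<close> is zero, the component of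
  \<open>f\<close> in degree \<open>deg b\<close> is replaced, as a function on the point set, by
  Artin monomials of smaller degree. The difference is a relation between functions, hence has zero
  coefficients, and the lower terms do not involve \<open>b\<close>.\<close>

lemma artin_independent_mod_gens:
  fixes V T :: "rat set"
  assumes "finite V" "T \<subseteq> V"
    and "f \<in> qv.span (monom_of ` artin_exps n (card V) (card T))"
    and "f \<in> qv.span (\<Union>e. gens n (card V) (card T) e)"
  shows "f = 0"
proof (rule poly_mapping_eqI)
  fix b
  let ?B = "artin_exps n (card V) (card T)"
  show "Poly_Mapping.lookup f b = Poly_Mapping.lookup 0 b"
  proof (cases "b \<in> ?B")
    case False
    then show ?thesis using span_monomials_keys[OF assms(3)] by (auto simp: in_keys_iff)
  next
    case True
    let ?p = "hom_part (deg b) f"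
    obtain g where g: "g \<in> qv.span (monom_of ` {a \<in> exps n. deg a < deg b})" "?p - g \<in> vanishing n V T"
      using span_mod_subspace[OF subspace_vanishing gens_deform[OF assms(1,2)]
          hom_part_span_gens[OF assms(4)]] by blast
    obtain r where r: "r \<in> qv.span (monom_of ` {b' \<in> ?B. deg b' < deg b})" "g - r \<in> vanishing n V T"
      using reduce_lower[OF assms(1,2) g(1)] by blast
    have keys_r: "Poly_Mapping.keys r \<subseteq> {b' \<in> ?B. deg b' < deg b}"
      using span_monomials_keys[OF r(1)] .
    have "Poly_Mapping.keys ?p \<subseteq> ?B"
      using span_monomials_keys[OF assms(3)] by (auto simp: in_keys_iff lookup_hom_part split: if_splits)
    then have keys: "Poly_Mapping.keys (?p - r) \<subseteq> ?B"
      using keys_diff[of ?p r] keys_r by blast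
    have "?p - r \<in> vanishing n V T"
      using qv.subspace_add[OF subspace_vanishing g(2) r(2)] by simp
    then have "(\<Sum>b\<in>?B. Poly_Mapping.lookup (?p - r) b * monom_val y b) = 0" if "y \<in> words n V T" for y
      using that eval_at_superset[OF finite_artin_exps keys] by (simp add: vanishing_def)
    then have "Poly_Mapping.lookup (?p - r) b = 0"
      by (rule artin_exps_independent[OF assms(1,2) _ True])
    moreover have "Poly_Mapping.lookup r b = 0"
      using keys_r by (auto simp: in_keys_iff)
    ultimately show ?thesis by (simp add: lookup_minus lookup_hom_part)
  qed
qed

section \<open>The ideal and the quotient\<close>

lemma carrier_QX_iff: "p \<in> carrier (QX n) \<longleftrightarrow> p \<in> qv.span (monom_of ` exps n)"
proof
  assume "p \<in> carrier (QX n)"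
  then show "p \<in> qv.span (monom_of ` exps n)"
    by (intro in_span_monomials) (auto simp: QX_def exps_def)
next
  assume "p \<in> qv.span (monom_of ` exps n)"
  then show "p \<in> carrier (QX n)"
    using span_monomials_keys by (fastforce simp: QX_def exps_def)
qed

text \<open>A monomial times a generator in some \<open>gens n k k d\<close> is again such a
  generator, so the linear span is already closed under multiplication by the ring.\<close>

lemma ideal_nk_eq_span:
  assumes "1 \<le> k" "k \<le> n"
  shows "ideal_nk n k = qv.span (\<Union>d. gens n k k d)" (is "_ = qv.span ?G")
proof
  interpret R: cring "QX n" by (rule QX_cring)
  interpret I: ideal "ideal_nk n k" "QX n" by (rule ideal_nk_ideal)
  let ?S = "{var i ^ k | i. i \<in> {1..n}} \<union> {elem_sym n d | d. d \<in> {n - k + 1..n}}"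
  have elem_sym_carrier: "elem_sym n d \<in> carrier (QX n)" for d
    unfolding elem_sym_def by (intro carrier_sum carrier_prod carrier_var) auto
  have S_carrier: "?S \<subseteq> carrier (QX n)"
    using elem_sym_carrier by (auto intro!: carrier_power carrier_var)
  have S_ideal: "?S \<subseteq> ideal_nk n k"
    unfolding ideal_nk_def by (rule R.genideal_self[OF S_carrier])
  have mult_ideal: "q * x \<in> ideal_nk n k" if "x \<in> ideal_nk n k" "q \<in> carrier (QX n)" for q x
    using I.I_l_closed[OF that] by (simp add: QX_simps)
  have add_ideal: "x + y \<in> ideal_nk n k" if "x \<in> ideal_nk n k" "y \<in> ideal_nk n k" for x y
    using I.a_closed[OF that] by (simp add: QX_simps)
  have zero_ideal: "0 \<in> ideal_nk n k"
    using I.zero_closed by (simp add: QX_simps)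
  have "gens n k k d \<subseteq> ideal_nk n k" for d
  proof
    fix x assume "x \<in> gens n k k d"
    then consider (var) a i where "x = monom_of a * var i ^ k" "a \<in> exps n" "i \<in> {1..n}"
      | (sym) a r where "x = monom_of a * elem_sym n r" "a \<in> exps n" "n < r + k"
      unfolding gens_def by blast
    then show "x \<in> ideal_nk n k"
    proof cases
      case var
      then have "var i ^ k \<in> ideal_nk n k" using S_ideal by blast
      then show ?thesis using var(1,2) mult_ideal by (simp add: carrier_monom exps_def)
    next
      case sym
      have "elem_sym n r \<in> ideal_nk n k"
      \<comment> \<open>Beyond degree \<open>n\<close> the elements of \<open>gens\<close> are zero,
        although they are not among the ideal generators.\<close>
      proof (cases "r \<le> n")
        case True
        then have "r \<in> {n - k + 1..n}" using sym(3) assms by auto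
        then show ?thesis using S_ideal by blast
      next
        case False
        then show ?thesis using zero_ideal by (simp add: elem_sym_gt)
      qed
      then show ?thesis using sym(1,2) mult_ideal by (simp add: carrier_monom exps_def)
    qed
  qed
  moreover have "qv.subspace (ideal_nk n k)"
    by (rule qv.subspaceI) (use zero_ideal add_ideal mult_ideal carrier_const in auto)
  ultimately show "qv.span ?G \<subseteq> ideal_nk n k"
    by (intro qv.span_minimal) auto
  have gen_carrier: "x \<in> carrier (QX n)" if "x \<in> ?G" for x
    using that unfolding gens_def
    by (auto intro!: carrier_mult carrier_power carrier_var elem_sym_carrier simp: carrier_monom exps_def)
  have mult_gen: "monom_of b * x \<in> ?G" if "x \<in> ?G" "b \<in> exps n" for b x
  proof -
    consider (var) a i where "x = monom_of a * var i ^ k" "a \<in> exps n" "i \<in> {1..n}"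
      | (sym) a r where "x = monom_of a * elem_sym n r" "a \<in> exps n" "n < r + k"
      using \<open>x \<in> ?G\<close> unfolding gens_def by blast
    then show ?thesis
    proof cases
      case var
      have "monom_of (b + a) * var i ^ k \<in> gens n k k (deg (b + a) + k)"
        using var that(2) by (intro gens_varI exps_add) auto
      then show ?thesis by (auto simp: var(1) monom_of_add mult.assoc)
    next
      case sym
      have "monom_of (b + a) * elem_sym n r \<in> gens n k k (deg (b + a) + r)"
        using sym that(2) by (intro gens_elem_symI exps_add) auto
      then show ?thesis by (auto simp: sym(1) monom_of_add mult.assoc)
    qed
  qed
  have mult_span: "q * p \<in> qv.span ?G" if p: "p \<in> qv.span ?G" and q: "q \<in> carrier (QX n)" for p q
  proof (rule span_mult_image[OF p])
    fix x assume x: "x \<in> ?G"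
    \<comment> \<open>The roles of the factors are exchanged, so that linearity is now used in
      \<open>q\<close> and reduces it to a monomial.\<close>
    have "x * q \<in> qv.span ?G"
    proof (rule span_mult_image)
      show "q \<in> qv.span (monom_of ` exps n)" using q by (simp only: carrier_QX_iff)
      fix y assume "y \<in> monom_of ` exps n"
      then have "y * x \<in> ?G" using mult_gen[OF x] by blast
      then show "x * y \<in> qv.span ?G" unfolding mult.commute[of x] by (rule qv.span_base)
    qed
    then show "q * x \<in> qv.span ?G" by (simp add: mult.commute)
  qed
  have span_carrier: "qv.span ?G \<subseteq> carrier (QX n)"
  proof (rule qv.span_minimal)
    show "qv.subspace (carrier (QX n))"
      by (rule qv.subspaceI) (auto simp: carrier_QX_iff qv.span_zero qv.span_add qv.span_scale)
  qed (use gen_carrier in blast)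
  have "ideal (qv.span ?G) (QX n)"
  proof (rule idealI[OF R.ring_axioms])
    show "subgroup (qv.span ?G) (add_monoid (QX n))"
    proof (rule R.add.subgroupI)
      show "qv.span ?G \<subseteq> carrier (QX n)" by (rule span_carrier)
      show "qv.span ?G \<noteq> {}" using qv.span_zero by blast
    next
      fix p assume p: "p \<in> qv.span ?G"
      have "\<ominus>\<^bsub>QX n\<^esub> p = - p"
      proof (rule R.minus_equality)
        show "- p \<oplus>\<^bsub>QX n\<^esub> p = \<zero>\<^bsub>QX n\<^esub>" by (simp add: QX_simps)
        show "p \<in> carrier (QX n)" using p span_carrier by blast
        show "- p \<in> carrier (QX n)" using qv.span_neg[OF p] span_carrier by blast
      qed
      then show "\<ominus>\<^bsub>QX n\<^esub> p \<in> qv.span ?G" using qv.span_neg[OF p] by simp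
    next
      fix p q assume "p \<in> qv.span ?G" "q \<in> qv.span ?G"
      then show "p \<oplus>\<^bsub>QX n\<^esub> q \<in> qv.span ?G" by (simp add: QX_simps qv.span_add)
    qed
  next
    fix p q assume "p \<in> qv.span ?G" "q \<in> carrier (QX n)"
    then show "q \<otimes>\<^bsub>QX n\<^esub> p \<in> qv.span ?G" "p \<otimes>\<^bsub>QX n\<^esub> q \<in> qv.span ?G"
      using mult_span by (simp_all add: QX_simps mult.commute)
  qed
  moreover have "?S \<subseteq> qv.span ?G"
  proof
    fix x assume "x \<in> ?S"
    then consider (var) i where "x = var i ^ k" "i \<in> {1..n}"
      | (sym) d where "x = elem_sym n d" "d \<in> {n - k + 1..n}" by blast
    then have "x \<in> ?G"
    proof cases
      case var
      then have "monom_of 0 * var i ^ k \<in> gens n k k k" by (intro gens_varI) auto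
      then show ?thesis by (auto simp: var(1) monom_of_0)
    next
      case sym
      then have "monom_of 0 * elem_sym n d \<in> gens n k k d" by (intro gens_elem_symI) auto
      then show ?thesis by (auto simp: sym(1) monom_of_0)
    qed
    then show "x \<in> qv.span ?G" by (rule qv.span_base)
  qed
  ultimately show "ideal_nk n k \<subseteq> qv.span ?G"
    unfolding ideal_nk_def by (rule R.genideal_minimal)
qed

section \<open>Cosets and their linear combinations\<close>

lemma coset_nk_eq_iff:
  assumes "p \<in> carrier (QX n)" "q \<in> carrier (QX n)"
  shows "coset_nk n k p = coset_nk n k q \<longleftrightarrow> p - q \<in> ideal_nk n k"
proof -
  interpret I: ideal "ideal_nk n k" "QX n" by (rule ideal_nk_ideal)
  have "- q \<in> carrier (QX n)" using assms(2) by (simp add: QX_def)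
  then have "p \<ominus>\<^bsub>QX n\<^esub> q = p - q"
    using I.minus_equality[of "- q" q] assms(2) by (simp add: a_minus_def QX_simps)
  then show ?thesis
    using I.quotient_eq_iff_same_a_r_cos[OF ideal_nk_ideal assms] by (simp add: coset_nk_def)
qed

text \<open>The quotient map is linear. Injectivity on \<open>M\<close> ensures that the sum over
  cosets has one term for each polynomial in \<open>M\<close>.\<close>

lemma coset_nk_lincomb:
  assumes "finite M" "M \<subseteq> carrier (QX n)" "inj_on (coset_nk n k) M"
  shows "module.lincomb (R_nk n k) c (coset_nk n k ` M) =
    coset_nk n k (\<Sum>m\<in>M. const_poly (c (coset_nk n k m)) * m)"
proof -
  let ?h = "coset_nk n k"
  interpret I: ideal "ideal_nk n k" "QX n" by (rule ideal_nk_ideal)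
  interpret V: vectorspace class_ring "R_nk n k" by (rule R_nk_vectorspace)
  have hom: "?h \<in> ring_hom (QX n) (QX n Quot ideal_nk n k)"
    using I.rcos_ring_hom by (simp add: coset_nk_def[abs_def])
  have closed: "?h p \<in> carrier (R_nk n k)" if "p \<in> carrier (QX n)" for p
    using ring_hom_closed[OF hom that] by (simp add: R_nk_def Let_def)
  have add: "?h (p + q) = ?h p \<oplus>\<^bsub>R_nk n k\<^esub> ?h q"
    if "p \<in> carrier (QX n)" "q \<in> carrier (QX n)" for p q
    using ring_hom_add[OF hom that] by (simp add: R_nk_def Let_def QX_simps)
  have scale: "?h (const_poly a * p) = a \<odot>\<^bsub>R_nk n k\<^esub> ?h p" if "p \<in> carrier (QX n)" for a p
    using ring_hom_mult[OF hom carrier_const that] by (simp add: R_nk_def Let_def QX_simps)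
  have zero: "?h 0 = \<zero>\<^bsub>R_nk n k\<^esub>"
    using ring_hom_zero[OF hom I.ring_axioms ideal.quotient_is_ring[OF ideal_nk_ideal]]
    by (simp add: R_nk_def Let_def QX_simps)
  show ?thesis
    using assms
  proof (induction M rule: finite_induct)
    case empty
    then show ?case by (simp add: V.lincomb_def zero)
  next
    case (insert m M)
    have m: "m \<in> carrier (QX n)" and M: "M \<subseteq> carrier (QX n)" using insert.prems by auto
    have nin: "?h m \<notin> ?h ` M" using insert by auto
    have sum: "(\<Sum>m\<in>M. const_poly (c (?h m)) * m) \<in> carrier (QX n)"
      using M by (intro carrier_sum carrier_mult carrier_const) auto
    have "V.lincomb c (?h ` insert m M) = c (?h m) \<odot>\<^bsub>R_nk n k\<^esub> ?h m \<oplus>\<^bsub>R_nk n k\<^esub> V.lincomb c (?h ` M)"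
      unfolding V.lincomb_def image_insert
      by (rule V.finsum_insert) (use insert.hyps nin closed m M in \<open>auto intro!: V.smult_closed\<close>)
    also have "\<dots> = ?h (const_poly (c (?h m)) * m + (\<Sum>m\<in>M. const_poly (c (?h m)) * m))"
      using insert m M sum
      by (simp add: add carrier_mult carrier_const scale)
    finally show ?case using insert.hyps by simp
  qed
qed

theorem theorem4p13:
  fixes n k :: nat
  assumes "1 \<le> k" and "k \<le> n"
  shows "artin_monomials n k = nonskip_monomials n k \<and>
         inj_on (coset_nk n k) (artin_monomials n k) \<and>
         vectorspace.basis class_ring (R_nk n k) (coset_nk n k ` artin_monomials n k)"
proof (intro conjI)
  let ?B = "artin_exps n k k"
  let ?A = "artin_monomials n k"
  let ?h = "coset_nk n k"
  interpret V: vectorspace class_ring "R_nk n k" by (rule R_nk_vectorspace)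
  have A: "?A = monom_of ` ?B" using artin_monomials_eq[OF assms] .
  show "?A = nonskip_monomials n k" using A nonskip_monomials_eq[OF assms] by simp
  \<comment> \<open>Any \<open>k\<close> distinct rationals would do. Both \<open>V\<close> and
    \<open>T\<close> are taken to be \<open>W\<close>, because the ideal at hand is the case
    \<open>j = k\<close>.\<close>
  define W where "W = (of_nat :: nat \<Rightarrow> rat) ` {..<k}"
  have W: "finite W" "card W = k" unfolding W_def by (simp_all add: card_image inj_on_def)
  have indep: "f = 0" if "f \<in> qv.span ?A" "f \<in> ideal_nk n k" for f
    using artin_independent_mod_gens[OF W(1) order_refl, of f n] that ideal_nk_eq_span[OF assms]
    by (simp only: W(2) A)
  have finA: "finite ?A" unfolding A by (simp add: finite_artin_exps)
  have A_carrier: "?A \<subseteq> carrier (QX n)"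
    using artin_exps_in_exps by (auto simp: A carrier_monom exps_def)
  show inj: "inj_on ?h ?A"
  proof (rule inj_onI)
    fix p q assume pq: "p \<in> ?A" "q \<in> ?A" "?h p = ?h q"
    then have "p - q \<in> ideal_nk n k"
      using A_carrier coset_nk_eq_iff[of p n q k] by blast
    moreover have "p - q \<in> qv.span ?A" using pq by (intro qv.span_diff qv.span_base)
    ultimately show "p = q" using indep by fastforce
  qed
  have hA: "?h p \<in> carrier (R_nk n k)" if "p \<in> carrier (QX n)" for p
    using that by (auto simp: R_nk_def Let_def FactRing_def A_RCOSETS_def' coset_nk_def)
  have hA_carrier: "?h ` ?A \<subseteq> carrier (R_nk n k)" using hA A_carrier by blast
  have sum_span: "(\<Sum>m\<in>?A. const_poly (c m) * m) \<in> qv.span ?A" for c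
    by (intro qv.span_sum qv.span_scale qv.span_base)
  have zero: "\<zero>\<^bsub>R_nk n k\<^esub> = ?h 0"
    using coset_nk_lincomb[of "{}" n k undefined] by (simp add: V.lincomb_def)
  have "V.lin_indpt (?h ` ?A)"
  proof (rule V.finite_lin_indpt2)
    fix c assume "V.lincomb c (?h ` ?A) = \<zero>\<^bsub>R_nk n k\<^esub>"
    then have "?h (\<Sum>m\<in>?A. const_poly (c (?h m)) * m) = ?h 0"
      using coset_nk_lincomb[OF finA A_carrier inj] zero by simp
    moreover have "(\<Sum>m\<in>?A. const_poly (c (?h m)) * m) \<in> carrier (QX n)"
      using A_carrier by (auto intro!: carrier_sum carrier_mult carrier_const)
    moreover have "0 \<in> carrier (QX n)" by (simp add: QX_def)
    ultimately have 0: "(\<Sum>m\<in>?A. const_poly (c (?h m)) * m) = 0"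
      using indep[OF sum_span] coset_nk_eq_iff by fastforce
    have "c (?h (monom_of b)) = 0" if "b \<in> ?B" for b
    proof -
      have "(\<Sum>m\<in>?A. const_poly (c (?h m)) * m) = (\<Sum>b\<in>?B. const_poly (c (?h (monom_of b))) * monom_of b)"
        unfolding A by (subst sum.reindex) (auto simp: inj_on_def inj_monom_of)
      then have "Poly_Mapping.lookup (\<Sum>b\<in>?B. const_poly (c (?h (monom_of b))) * monom_of b) b = 0"
        using 0 by simp
      then have "(\<Sum>b'\<in>?B. if b' = b then c (?h (monom_of b)) else 0) = 0"
        unfolding lookup_sum lookup_const_mult lookup_monom_of
        by (subst sum.cong[OF refl]) auto
      then show ?thesis using that finite_artin_exps by simp
    qed
    then show "\<forall>v\<in>?h ` ?A. c v = \<zero>\<^bsub>class_ring\<^esub>" by (auto simp: A)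
  qed (use finA hA_carrier in auto)
  moreover have "V.span (?h ` ?A) = carrier (R_nk n k)"
  proof
    show "V.span (?h ` ?A) \<subseteq> carrier (R_nk n k)" using V.span_closed[OF hA_carrier] by blast
    show "carrier (R_nk n k) \<subseteq> V.span (?h ` ?A)"
    proof
      fix v assume "v \<in> carrier (R_nk n k)"
      then obtain p where p: "v = ?h p" "p \<in> carrier (QX n)"
        by (auto simp: R_nk_def Let_def FactRing_def A_RCOSETS_def' coset_nk_def)
      \<comment> \<open>Summing the degreewise reductions writes every polynomial as an Artin
        combination plus an element of the ideal.\<close>
      have "monom_of ` exps n \<subseteq> qv.span (?A \<union> (\<Union>d. gens n k k d))"
      proof
        fix x assume "x \<in> monom_of ` exps n"
        then obtain a where a: "x = monom_of a" "a \<in> exps n" by blast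
        have "monom_of ` {b \<in> ?B. deg b = deg a} \<union> gens n k k (deg a) \<subseteq> ?A \<union> (\<Union>d. gens n k k d)"
          unfolding A by blast
        then show "x \<in> qv.span (?A \<union> (\<Union>d. gens n k k d))"
          using monom_of_reducible[OF a(2), of k k] qv.span_mono unfolding a(1) reducible_def by blast
      qed
      then have "p \<in> qv.span (?A \<union> (\<Union>d. gens n k k d))"
        using p(2) qv_span_subsetI unfolding carrier_QX_iff by blast
      then obtain r q where rq: "p = r + q" "r \<in> qv.span ?A" "q \<in> ideal_nk n k"
        unfolding qv.span_Un ideal_nk_eq_span[OF assms] by blast
      obtain c where c: "r = (\<Sum>m\<in>?A. const_poly (c m) * m)"
        using rq(2) unfolding qv.span_finite[OF finA] by blast
      have r: "r \<in> carrier (QX n)"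
        using A_carrier unfolding c by (auto intro!: carrier_sum carrier_mult carrier_const)
      \<comment> \<open>Coefficients in the quotient are indexed by cosets, so they are transported
        along the inverse of the injective coset map.\<close>
      define c' where "c' v = c (the_inv_into ?A ?h v)" for v
      have "v = ?h r" unfolding p(1) coset_nk_eq_iff[OF p(2) r] using rq by simp
      also have "r = (\<Sum>m\<in>?A. const_poly (c' (?h m)) * m)"
        unfolding c c'_def by (intro sum.cong refl) (simp add: the_inv_into_f_f[OF inj])
      also have "?h \<dots> = V.lincomb c' (?h ` ?A)"
        using coset_nk_lincomb[OF finA A_carrier inj, of c'] by simp
      finally show "v \<in> V.span (?h ` ?A)"
        unfolding V.span_def using finA by auto
    qed
  qed
  ultimately show "V.basis (?h ` ?A)"
    unfolding V.basis_def using hA_carrier by blast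
qed

end
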